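(* Let $P\in\mathbb{R}[x,y]$ be a binary cubic form with discriminant $D_P>0$. Then $$\mathrm{Spec}(P)=\left[0,\sqrt[4]{\frac{D_P}{49}}\right].$$
   Context: A binary cubic form is a homogeneous polynomial of degree $3$ in two variables with real coefficients; $D_P$ denotes its discriminant (normalized so that $x^3+x^2y-2xy^2-y^3$ has discriminant $49$). A lattice $\Lambda\subset\mathbb{R}^2$ is unimodular if it has covolume $1$. For a binary form $P$, $$\mathrm{Spec}(P):=\left\{\inf_{v\in\Lambda\setminus\{0\}}|P(v)| : \Lambda\subset\mathbb{R}^2 \text{ a unimodular lattice}\right\}.$$ *)

theory Defs
  imports "HOL-Analysis.Analysis" "HOL-Computational_Algebra.Polynomial"
begin

text \<open>
  A polynomial in \<open>\<real>[x, y] = \<real>[x][y]\<close> is a \<open>real poly poly\<close> whose outer variable is \<open>y\<close> and whose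
  inner variable is \<open>x\<close>.
\<close>

definition bicoeff :: "real poly poly \<Rightarrow> nat \<Rightarrow> nat \<Rightarrow> real" \<comment> \<open>the coefficient of \<open>x ^ i * y ^ j\<close>\<close>
  where "bicoeff P i j = coeff (coeff P j) i"

definition eval_form :: "real poly poly \<Rightarrow> real ^ 2 \<Rightarrow> real"
  where "eval_form P v = poly (poly P [:v $ 2:]) (v $ 1)"

definition binary_form :: "nat \<Rightarrow> real poly poly \<Rightarrow> bool"
  where "binary_form n P \<longleftrightarrow> (\<forall>i j. bicoeff P i j \<noteq> 0 \<longrightarrow> i + j = n)"

definition cubic_disc :: "real poly poly \<Rightarrow> real"
  where "cubic_disc P =
    (let a = bicoeff P 3 0; b = bicoeff P 2 1; c = bicoeff P 1 2; d = bicoeff P 0 3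
     in b\<^sup>2 * c\<^sup>2 - 4 * a * c ^ 3 - 4 * b ^ 3 * d - 27 * a\<^sup>2 * d\<^sup>2 + 18 * a * b * c * d)"

text \<open>
  The columns of \<open>A\<close> are linearly independent and \<open>L\<close> is their integer span.
\<close>
definition lattice_basis :: "(real ^ 'n) set \<Rightarrow> real ^ 'n ^ 'n \<Rightarrow> bool"
  where "lattice_basis L A \<longleftrightarrow> invertible A \<and> L = {A *v z | z. \<forall>i. z $ i \<in> \<int>}"

definition euclidean_lattice :: "(real ^ 'n) set \<Rightarrow> bool"
  where "euclidean_lattice L \<longleftrightarrow> (\<exists>A. lattice_basis L A)"

text \<open>
  The value does not depend on the chosen basis, see \<open>covolume_eq\<close> below.
\<close>
definition covolume :: "(real ^ 'n) set \<Rightarrow> real"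
  where "covolume L = \<bar>det (SOME A. lattice_basis L A)\<bar>"

definition unimodular :: "(real ^ 'n) set \<Rightarrow> bool"
  where "unimodular L \<longleftrightarrow> euclidean_lattice L \<and> covolume L = 1"

text \<open>
  The infimum is over a nonempty set of nonnegative reals, so the conditionally complete
  \<open>Inf\<close> on \<open>real\<close> is the true infimum.
\<close>
definition Spec :: "real poly poly \<Rightarrow> real set"
  where "Spec P = {(INF v\<in>L - {0}. \<bar>eval_form P v\<bar>) | L :: (real ^ 2) set. unimodular L}"

lemma cubic_disc_normalization:
  \<comment> \<open>the form \<open>x ^ 3 + x\<^sup>2 * y - 2 * x * y\<^sup>2 - y ^ 3\<close>\<close>
  "cubic_disc [:[:0, 0, 0, 1:], [:0, 0, 1:], [:0, -2:], [:-1:]:] = 49"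
  by (simp add: cubic_disc_def bicoeff_def numeral_3_eq_3 numeral_2_eq_2 coeff_pCons split: nat.splits)

lemma eval_binary_cubic_form:
  assumes "binary_form 3 P"
  shows "eval_form P v = bicoeff P 3 0 * (v $ 1) ^ 3 + bicoeff P 2 1 * (v $ 1)\<^sup>2 * v $ 2
    + bicoeff P 1 2 * v $ 1 * (v $ 2)\<^sup>2 + bicoeff P 0 3 * (v $ 2) ^ 3"
proof -
  have z: "bicoeff P i j = 0" if "i + j \<noteq> 3" for i j
    using assms that unfolding binary_form_def by blast
  have c: "coeff P j = (if j \<le> 3 then monom (bicoeff P (3 - j) j) (3 - j) else 0)" for j
    using z by (intro poly_eqI) (auto simp: bicoeff_def)
  have "degree P \<le> 3"
    by (rule degree_le) (auto simp: c)
  then have "poly P [:v $ 2:] = (\<Sum>j\<le>3. coeff P j * [:v $ 2:] ^ j)"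
    unfolding poly_altdef by (intro sum.mono_neutral_left) (auto simp: coeff_eq_0)
  then show ?thesis
    unfolding eval_form_def
    by (simp add: poly_sum c poly_monom numeral_3_eq_3 numeral_2_eq_2)
qed

lemma covolume_eq:
  fixes A :: "real ^ 'n ^ 'n"
  assumes "lattice_basis L A"
  shows "covolume L = \<bar>det A\<bar>"
proof -
  have le: "\<bar>det A\<bar> \<le> \<bar>det B\<bar>" if A: "lattice_basis L A" and B: "lattice_basis L B"
    for A B :: "real ^ 'n ^ 'n"
  proof -
    have "\<exists>z. column j B = A *v z \<and> (\<forall>i. z $ i \<in> \<int>)" for j
    proof -
      have "B *v axis j 1 \<in> L"
        using B unfolding lattice_basis_def by (auto simp: axis_def)
      then show ?thesis
        using A unfolding lattice_basis_def by (auto simp: matrix_vector_mult_basis)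
    qed
    then obtain z where z: "\<And>j. column j B = A *v z j" "\<And>i j. z j $ i \<in> \<int>"
      by metis
    define M :: "real ^ 'n ^ 'n" where "M = (\<chi> i j. z j $ i)"
    have "B = A ** M"
    proof -
      have "B $ i $ j = (A ** M) $ i $ j" for i j
        using z(1)[of j]
        by (simp add: vec_eq_iff column_def M_def matrix_matrix_mult_def matrix_vector_mult_def)
      then show ?thesis
        by (simp add: vec_eq_iff)
    qed
    then have "det B = det A * det M"
      by (simp add: det_mul)
    moreover have "det M \<in> \<int>"
      unfolding det_def M_def by (auto intro!: Ints_sum Ints_mult Ints_prod z)
    moreover have "det B \<noteq> 0"
      using B by (simp add: lattice_basis_def invertible_det_nz)
    ultimately show ?thesis
      using Ints_nonzero_abs_ge1[of "det M"] mult_left_mono[of 1 "\<bar>det M\<bar>" "\<bar>det A\<bar>"]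
      by (auto simp: abs_mult)
  qed
  have "lattice_basis L (SOME A. lattice_basis L A)"
    using assms by (rule someI)
  then show ?thesis
    unfolding covolume_def using le assms by (meson antisym)
qed

end

theory Submission
  imports Defs
begin

text \<open>
  A unimodular lattice \<open>A \<int>\<^sup>2\<close> turns \<open>P\<close> into the cubic form \<open>P \<circ> A\<close> on \<open>\<int>\<^sup>2\<close>, which has the same
  discriminant \<open>D\<close> because \<open>\<bar>det A\<bar> = 1\<close>. Conversely all cubic forms of discriminant \<open>D > 0\<close> are
  equivalent under matrices of determinant \<open>\<plusminus>1\<close> (\<open>canonical_form\<close>: each is equivalent to a multiple of
  \<open>y (x\<^sup>2 - y\<^sup>2)\<close>). So the spectrum is the set of the numbers \<open>inf \<bar>F\<bar>\<close>, taken over the nonzero integer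
  points, where \<open>F\<close> ranges over all real cubic forms of discriminant \<open>D\<close> (\<open>Spec_eq_form_inf\<close>).

  Upper bound (\<open>minimum_bound\<close>). By homogeneity it suffices that \<open>D \<ge> 49\<close> if \<open>\<bar>F\<bar> \<ge> 1\<close> at all nonzero
  integer points. The Hessian of \<open>F\<close> is a positive definite quadratic form, and one may take it to be
  reduced. Let \<open>A\<close>, \<open>C\<close>, \<open>E\<close> be its values at the three shortest vectors \<open>v\<close>. If \<open>D < 49\<close>, the syzygy
  \<open>4 H\<^sup>3 = G\<^sup>2 + 27 D F\<^sup>2\<close> gives \<open>4 A\<^sup>3 \<ge> 27 D\<close>, and together with \<open>A C \<le> D\<close> this forces the Hessian to be
  nearly hexagonal and \<open>\<bar>F(v)\<bar>\<close> to lie between \<open>1\<close> and \<open>4/3\<close>; the polarised syzygy shows moreover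
  that \<open>F\<close> has the same sign at the three vectors, if these are chosen with sum zero. Fixing these
  three values leaves one parameter \<open>n\<close>, and the values of \<open>F\<close> at the differences of the three vectors
  are \<open>2 n\<close> up to a small error; hence \<open>\<bar>n\<bar> \<ge> 1/2\<close>, and an explicit estimate gives
  \<open>D \<ge> (n\<^sup>2 + 27/4)\<^sup>2 \<ge> 49\<close>.

  All values occur (\<open>form_inf_attains\<close>). The form \<open>f = x\<^sup>3 + x\<^sup>2 y - 2 x y\<^sup>2 - y\<^sup>3\<close> has discriminant \<open>49\<close> and
  takes nonzero integral values, so its multiple of discriminant \<open>D\<close> attains the upper bound. For
  smaller values keep two roots \<open>\<alpha>\<close>, \<open>\<gamma>\<close> of \<open>f\<close>, move the third root \<open>b\<close>, and keep the discriminant equal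
  to \<open>D\<close> by scaling. The key is \<open>perturb_root\<close>: if the infimum exceeds \<open>t\<close> at \<open>b\<close>, then arbitrarily near
  \<open>b\<close> there is a root for which the infimum lies in \<open>[t, t + \<epsilon>]\<close>. For this, take a good rational
  approximation \<open>p/q\<close> of \<open>b\<close> and put the new root at distance about \<open>1/q\<^sup>3\<close> from \<open>p/q\<close>, so that the value
  at \<open>(p, q)\<close> is almost \<open>t\<close>. The new root is the image of \<open>m + \<surd>2\<close> under a matrix in \<open>SL\<^sub>2(\<int>)\<close> with first
  column \<open>(p, q)\<close>; as \<open>\<surd>2\<close> is badly approximable, the values at the other integer points near the
  moved line are large, whereas far from that line the values hardly decrease. Iterating this with
  \<open>\<epsilon> \<rightarrow> 0\<close> inside nested intervals gives a root for which the infimum is exactly \<open>t\<close>.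
\<close>

section \<open>Binary cubic forms and their covariants\<close>

text \<open>The binary cubic form with coefficients \<open>a\<close>, \<open>b\<close>, \<open>c\<close>, \<open>d\<close>, as a function.\<close>
definition cubic :: "real \<Rightarrow> real \<Rightarrow> real \<Rightarrow> real \<Rightarrow> real \<Rightarrow> real \<Rightarrow> real"
  where "cubic a b c d x y = a * x ^ 3 + b * x\<^sup>2 * y + c * x * y\<^sup>2 + d * y ^ 3"

text \<open>The discriminant of \<open>cubic a b c d\<close>.\<close>
definition disc :: "real \<Rightarrow> real \<Rightarrow> real \<Rightarrow> real \<Rightarrow> real"
  where "disc a b c d =
    b\<^sup>2 * c\<^sup>2 - 4 * a * c ^ 3 - 4 * b ^ 3 * d - 27 * a\<^sup>2 * d\<^sup>2 + 18 * a * b * c * d"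

text \<open>
  The Hessian covariant of \<open>cubic a b c d\<close>, normalised to be a quadratic form of discriminant
  \<open>- 3 * disc a b c d\<close>.
\<close>
definition hess :: "real \<Rightarrow> real \<Rightarrow> real \<Rightarrow> real \<Rightarrow> real \<Rightarrow> real \<Rightarrow> real"
  where "hess a b c d x y = (b\<^sup>2 - 3 * a * c) * x\<^sup>2 + (b * c - 9 * a * d) * x * y + (c\<^sup>2 - 3 * b * d) * y\<^sup>2"

lemma disc_hess: "3 * disc a b c d = 4 * (b\<^sup>2 - 3 * a * c) * (c\<^sup>2 - 3 * b * d) - (b * c - 9 * a * d)\<^sup>2"
  unfolding disc_def by algebra

text \<open>
  The syzygy \<open>4 H\<^sup>3 = G\<^sup>2 + 27 D F\<^sup>2\<close> between a cubic form \<open>F\<close>, its Hessian \<open>H\<close> and its cubic covariant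
  \<open>G\<close>, evaluated at \<open>(1, 0)\<close>.
\<close>
lemma syzygy:
  "4 * (b\<^sup>2 - 3 * a * c) ^ 3 = (2 * b ^ 3 - 9 * a * b * c + 27 * a\<^sup>2 * d)\<^sup>2 + 27 * disc a b c d * a\<^sup>2"
  unfolding disc_def by algebra

text \<open>
  In coordinates in which \<open>H\<close> is a multiple of \<open>\<bar>z\<bar>\<^sup>2\<close>, the covariants \<open>F\<close> and \<open>G\<close> are multiples of the real
  and the imaginary part of \<open>z\<^sup>3\<close>. The syzygy expresses \<open>\<bar>z\<^sup>3\<bar>\<^sup>2\<close>; its polarisation, stated here at the pair
  \<open>(1, 0)\<close>, \<open>(0, 1)\<close>, expresses the inner product of two cubes \<open>z\<^sup>3\<close> and \<open>w\<^sup>3\<close> by the Hessian.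
\<close>
lemma syzygy_polar:
  "27 * disc a b c d * (a * d) =
     (2 * b ^ 3 - 9 * a * b * c + 27 * a\<^sup>2 * d) * (2 * c ^ 3 - 9 * b * c * d + 27 * a * d\<^sup>2)
     - 2 * (b * c - 9 * a * d) * (3 * (b\<^sup>2 - 3 * a * c) * (c\<^sup>2 - 3 * b * d) - (b * c - 9 * a * d)\<^sup>2)"
  unfolding disc_def by algebra

lemma disc_reverse: "disc d c b a = disc a b c d"
  unfolding disc_def by algebra

lemma cubic_subst:
  fixes a b c d r s t u :: real
  shows "\<exists>a' b' c' d'.
    (\<forall>x y. cubic a' b' c' d' x y = cubic a b c d (r * x + s * y) (t * x + u * y)) \<and>
    (\<forall>x y. hess a' b' c' d' x y = (r * u - s * t)\<^sup>2 * hess a b c d (r * x + s * y) (t * x + u * y)) \<and>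
    disc a' b' c' d' = (r * u - s * t) ^ 6 * disc a b c d"
proof -
  define a' where "a' = a * r ^ 3 + b * r\<^sup>2 * t + c * r * t\<^sup>2 + d * t ^ 3"
  define b' where "b' = 3 * a * r\<^sup>2 * s + b * (r\<^sup>2 * u + 2 * r * s * t) + c * (2 * r * t * u + s * t\<^sup>2) + 3 * d * t\<^sup>2 * u"
  define c' where "c' = 3 * a * r * s\<^sup>2 + b * (s\<^sup>2 * t + 2 * r * s * u) + c * (2 * s * t * u + r * u\<^sup>2) + 3 * d * t * u\<^sup>2"
  define d' where "d' = a * s ^ 3 + b * s\<^sup>2 * u + c * s * u\<^sup>2 + d * u ^ 3"
  note defs = a'_def b'_def c'_def d'_def
  define A B C where ABC: "A = b\<^sup>2 - 3 * a * c" "B = b * c - 9 * a * d" "C = c\<^sup>2 - 3 * b * d"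
  have 1: "b'\<^sup>2 - 3 * a' * c' = (r * u - s * t)\<^sup>2 * (A * r\<^sup>2 + B * r * t + C * t\<^sup>2)"
    unfolding defs ABC by algebra
  have 2: "b' * c' - 9 * a' * d' = (r * u - s * t)\<^sup>2 * (2 * A * r * s + B * (r * u + s * t) + 2 * C * t * u)"
    unfolding defs ABC by algebra
  have 3: "c'\<^sup>2 - 3 * b' * d' = (r * u - s * t)\<^sup>2 * (A * s\<^sup>2 + B * s * u + C * u\<^sup>2)"
    unfolding defs ABC by algebra
  have h: "hess a' b' c' d' x y = (r * u - s * t)\<^sup>2 * hess a b c d (r * x + s * y) (t * x + u * y)" for x y
    unfolding hess_def 1 2 3 ABC[symmetric] by algebra
  have "3 * disc a' b' c' d' = (r * u - s * t) ^ 6 * (3 * disc a b c d)"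
    unfolding disc_hess 1 2 3 ABC[symmetric] by algebra
  then have "disc a' b' c' d' = (r * u - s * t) ^ 6 * disc a b c d"
    by simp
  moreover have "cubic a' b' c' d' x y = cubic a b c d (r * x + s * y) (t * x + u * y)" for x y
    unfolding cubic_def defs by algebra
  ultimately show ?thesis
    using h by blast
qed

text \<open>Positive discriminant makes the Hessian positive at \<open>(1, 0)\<close>, unless the form vanishes there.\<close>
lemma hess_pos:
  assumes D: "disc a b c d > 0" and "a \<noteq> 0"
  shows "b\<^sup>2 - 3 * a * c > 0"
proof -
  have "27 * disc a b c d * a\<^sup>2 > 0"
    using assms by simp
  then have "4 * (b\<^sup>2 - 3 * a * c) ^ 3 > 0"
    unfolding syzygy[of b a c d] by (intro add_nonneg_pos) auto
  then show ?thesis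
    by (simp add: zero_less_power_eq)
qed

section \<open>Reduced forms with no small integral values\<close>

text \<open>
  The bounds \<open>g\<close> and \<open>h\<close> control the cubic covariant at \<open>(1, 0)\<close> and \<open>(0, 1)\<close>, so that the Hessian term in
  the polarised syzygy decides the sign of \<open>a * d\<close>.
\<close>
lemma opposite_signs:
  fixes a b c d :: real
  defines "A \<equiv> b\<^sup>2 - 3 * a * c" and "B \<equiv> b * c - 9 * a * d" and "C \<equiv> c\<^sup>2 - 3 * b * d"
  assumes D: "disc a b c d > 0" and a: "a\<^sup>2 \<ge> 1" and d: "d\<^sup>2 \<ge> 1"
    and g: "4 * A ^ 3 - 27 * disc a b c d \<le> g\<^sup>2" "g \<ge> 0"
    and h: "4 * C ^ 3 - 27 * disc a b c d \<le> h\<^sup>2" "h \<ge> 0"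
    and gh: "g * h < 2 * B * (3 * A * C - B\<^sup>2)"
  shows "a * d < 0"
proof -
  let ?D = "disc a b c d"
  define G where "G = 2 * b ^ 3 - 9 * a * b * c + 27 * a\<^sup>2 * d"
  define H where "H = 2 * c ^ 3 - 9 * b * c * d + 27 * a * d\<^sup>2"
  have "?D * 1 \<le> ?D * a\<^sup>2" "?D * 1 \<le> ?D * d\<^sup>2"
    using a d D by (intro mult_left_mono; simp)+
  moreover have "4 * A ^ 3 = G\<^sup>2 + 27 * ?D * a\<^sup>2"
    unfolding A_def G_def by (rule syzygy)
  moreover have "4 * C ^ 3 = H\<^sup>2 + 27 * ?D * d\<^sup>2"
    using syzygy[of c d b a] unfolding C_def H_def disc_reverse[of d c b a] by (simp add: algebra_simps)
  ultimately have "G\<^sup>2 \<le> g\<^sup>2" "H\<^sup>2 \<le> h\<^sup>2"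
    using g(1) h(1) by linarith+
  then have "\<bar>G\<bar> \<le> g" "\<bar>H\<bar> \<le> h"
    using g(2) h(2) by (simp_all add: abs_le_square_iff[symmetric])
  then have "\<bar>G * H\<bar> \<le> g * h"
    unfolding abs_mult by (intro mult_mono) auto
  moreover have "27 * ?D * (a * d) = G * H - 2 * B * (3 * A * C - B\<^sup>2)"
    unfolding A_def B_def C_def G_def H_def by (rule syzygy_polar)
  ultimately have "?D * (a * d) < 0"
    using gh by linarith
  then show ?thesis
    using D by (simp add: mult_less_0_iff)
qed

text \<open>
  The form below is the general cubic form with the values \<open>p\<close>, \<open>q\<close>, \<open>w\<close> at \<open>(1, 0)\<close>, \<open>(0, -1)\<close>, \<open>(-1, 1)\<close>,
  three vectors with sum zero. The parameter \<open>n\<close> is normalised so that cyclic permutations of these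
  vectors permute \<open>p\<close>, \<open>q\<close>, \<open>w\<close> and fix \<open>n\<close>. For \<open>p = q = w = 1\<close> the discriminant is \<open>(n\<^sup>2 + 27/4)\<^sup>2\<close>.
\<close>
lemma normal_form_bound:
  fixes p q w n :: real
  assumes p: "1 \<le> p" "p \<le> 4/3" and q: "1 \<le> q" "q \<le> 4/3" and w: "1 \<le> w" "w \<le> 4/3"
    and n: "\<bar>n\<bar> \<ge> 1/2"
  shows "disc p (n + (3 * p - q + w) / 2) (n + (p - 3 * q - w) / 2) (- q) \<ge> 49"
proof -
  define x y z where xyz: "x = p - 1" "y = q - 1" "z = w - 1"
  define S where "S = x + y + z"
  define V where "V = (x - y) * (y - z) * (z - x)"
  define W where "W = 9 * S + 5 * (x * y + y * z + z * x) - 1/2 * (x\<^sup>2 + y\<^sup>2 + z\<^sup>2)"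
  define c0 where "c0 = 1/16*x^4 + 3/4*x^3*y + 3/4*x^3*z + 7/4*x^3 + x^2*y^2*(-13/8) + 61/4*x^2*y*z 
    + 57/4*x^2*y + x^2*z^2*(-13/8) + 57/4*x^2*z + 135/8*x^2 + 3/4*x*y^3 + 61/4*x*y^2*z
    + 57/4*x*y^2 + 61/4*x*y*z^2 + 183/2*x*y*z + 297/4*x*y + 3/4*x*z^3 
    + 57/4*x*z^2 + 297/4*x*z + 243/4*x + 1/16*y^4 + 3/4*y^3*z + 7/4*y^3
    + y^2*z^2*(-13/8) + 57/4*y^2*z + 135/8*y^2 + 3/4*y*z^3 + 57/4*y*z^2 + 297/4*y*z + 243/4*y
    + 1/16*z^4 + 7/4*z^3 + 135/8*z^2 + 243/4*z"
  have b: "0 \<le> x" "x \<le> 1/3" "0 \<le> y" "y \<le> 1/3" "0 \<le> z" "z \<le> 1/3"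
    using p q w unfolding xyz by auto
  have pqw: "p = 1 + x" "q = 1 + y" "w = 1 + z"
    unfolding xyz by auto
  have eq: "disc p (n + (3 * p - q + w) / 2) (n + (p - 3 * q - w) / 2) (- q) =
      (n\<^sup>2 + 27/4)\<^sup>2 + n\<^sup>2 * W + 4 * n * V + c0"
    unfolding W_def disc_def S_def V_def c0_def pqw by (simp add: field_simps power2_eq_square power3_eq_cube power4_eq_xxxx)
  have sq: "s\<^sup>2 \<le> s / 3" if "0 \<le> s" "s \<le> 1/3" for s :: real
    using mult_left_mono[OF that(2) that(1)] by (simp add: power2_eq_square)
  have c0: "c0 \<ge> 0"
  proof -
    have m: "s\<^sup>2 * t\<^sup>2 \<le> s\<^sup>2" if "0 \<le> t" "t \<le> 1/3" for s t :: real
      using mult_left_mono[of "t\<^sup>2" 1 "s\<^sup>2"] power_le_one[of t 2] that by simp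
    have "x\<^sup>2 * y\<^sup>2 \<le> x\<^sup>2" "x\<^sup>2 * z\<^sup>2 \<le> x\<^sup>2" "y\<^sup>2 * z\<^sup>2 \<le> y\<^sup>2"
      using m b by auto
    moreover have "0 \<le> 1/16*x^4 + 3/4*x^3*y + 3/4*x^3*z + 7/4*x^3 + 61/4*x^2*y*z 
    + 57/4*x^2*y + 57/4*x^2*z + 3/4*x*y^3 + 61/4*x*y^2*z
    + 57/4*x*y^2 + 61/4*x*y*z^2 + 183/2*x*y*z + 297/4*x*y + 3/4*x*z^3 
    + 57/4*x*z^2 + 297/4*x*z + 243/4*x + 1/16*y^4 + 3/4*y^3*z + 7/4*y^3
    + 57/4*y^2*z + 3/4*y*z^3 + 57/4*y*z^2 + 297/4*y*z + 243/4*y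
    + 1/16*z^4 + 7/4*z^3 + 135/8*z^2 + 243/4*z"
      using b by (intro add_nonneg_nonneg mult_nonneg_nonneg) auto
    moreover have "0 \<le> x\<^sup>2" "0 \<le> y\<^sup>2"
      by auto
    ultimately show ?thesis
      unfolding c0_def by linarith
  qed
  have V: "\<bar>V\<bar> \<le> S / 9"
  proof -
    have "\<bar>V\<bar> = \<bar>x - y\<bar> * (\<bar>y - z\<bar> * \<bar>z - x\<bar>)"
      by (simp add: V_def abs_mult)
    also have "\<dots> \<le> S * (1/3 * (1/3))"
    proof (intro mult_mono)
      show "\<bar>x - y\<bar> \<le> S" "\<bar>y - z\<bar> \<le> 1/3" "\<bar>z - x\<bar> \<le> 1/3" "0 \<le> S"
        using b unfolding S_def abs_le_iff by linarith+
    qed auto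
    finally show ?thesis by simp
  qed
  have nn: "\<bar>n\<bar> \<le> 2 * n\<^sup>2"
    using mult_right_mono[OF n, of "\<bar>n\<bar>"] by (simp add: power2_eq_square[symmetric])
  have n4: "n\<^sup>2 \<ge> 1/4"
    using n power_mono[of "1/2" "\<bar>n\<bar>" 2] by (simp add: power2_eq_square)
  have S0: "S \<ge> 0" using b by (simp add: S_def)
  have "\<bar>4 * n * V\<bar> = 4 * (\<bar>n\<bar> * \<bar>V\<bar>)"
    by (simp add: abs_mult)
  also have "\<bar>n\<bar> * \<bar>V\<bar> \<le> (2 * n\<^sup>2) * (S / 9)"
    using nn V S0 by (intro mult_mono) auto
  finally have 1: "4 * n * V \<ge> - n\<^sup>2 * (8/9 * S)"
    by (simp add: algebra_simps)
  have "8/9 * S \<le> W"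
  proof -
    have "0 \<le> x * y" "0 \<le> y * z" "0 \<le> z * x"
      using b by auto
    then have "0 \<le> x * y + y * z + z * x"
      by simp
    moreover have "x\<^sup>2 + y\<^sup>2 + z\<^sup>2 \<le> S / 3"
      using sq[OF b(1,2)] sq[OF b(3,4)] sq[OF b(5,6)] by (simp add: S_def)
    moreover have "8/9 * s \<le> 9 * s + 5 * m - 1/2 * l" if "0 \<le> m" "l \<le> s / 3" "0 \<le> s" for m l s :: real
      using that by linarith
    ultimately show ?thesis
      unfolding W_def using S0 by blast
  qed
  then have "n\<^sup>2 * (8/9 * S) \<le> n\<^sup>2 * W"
    by (rule mult_left_mono) simp
  moreover have "(n\<^sup>2 + 27/4)\<^sup>2 \<ge> 7\<^sup>2"
    using n4 by (intro power_mono) auto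
  ultimately show ?thesis
    unfolding eq using 1 c0 by (simp del: One_nat_def)
qed

text \<open>
  A form with \<open>D < 49\<close> is squeezed in two steps. The syzygy and \<open>A C \<le> D\<close> give \<open>27/4 \<le> A, C\<close>, hence
  the Hessian is nearly a multiple of \<open>x\<^sup>2 + x y + y\<^sup>2\<close>; then \<open>normal_form_bound\<close> applies.
\<close>
lemma reduced_bound_aux:
  fixes a b c d :: real
  defines "A \<equiv> b\<^sup>2 - 3 * a * c" and "B \<equiv> b * c - 9 * a * d" and "C \<equiv> c\<^sup>2 - 3 * b * d"
  assumes D0: "disc a b c d > 0" and a: "a \<ge> 1"
    and F: "\<And>x y :: int. (x, y) \<noteq> (0, 0) \<Longrightarrow> \<bar>cubic a b c d (of_int x) (of_int y)\<bar> \<ge> 1"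
    and BA: "B \<le> A" and BC: "B \<le> C" and B0: "B \<ge> 0"
  shows "disc a b c d \<ge> 49"
proof (rule ccontr)
  let ?D = "disc a b c d"
  assume "\<not> ?D \<ge> 49"
  then have D49: "?D < 49" by simp
  \<comment> \<open>the third short vector is \<open>(-1, 1)\<close>: \<open>w\<close> is the form and \<open>E\<close> the Hessian there\<close>
  define w where "w = - cubic a b c d 1 (-1)"
  define E where "E = A + C - B"
  have wd: "w = - a + b - c + d"
    by (simp add: w_def cubic_def)
  have D: "3 * ?D = 4 * A * C - B\<^sup>2"
    unfolding A_def B_def C_def by (rule disc_hess)
  have ge1: "1 \<le> s\<^sup>2" if "1 \<le> \<bar>s\<bar>" for s :: real
    using power_mono[of 1 "\<bar>s\<bar>" 2] that by simp
  have d: "\<bar>d\<bar> \<ge> 1" and w: "\<bar>w\<bar> \<ge> 1"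
    using F[of 0 1] F[of 1 "-1"] by (simp_all add: cubic_def w_def)
  have A0: "A > 0" and C0: "C > 0"
    using hess_pos[OF D0] hess_pos[of d c b a] a d D0 by (auto simp: A_def C_def disc_reverse algebra_simps)
  have B2: "B\<^sup>2 \<le> A * C"
    using mult_mono[OF BA BC] A0 B0 by (simp add: power2_eq_square)
  have DAC: "A * C \<le> ?D"
    using D B2 by linarith
  have sA: "27 * ?D * s\<^sup>2 \<le> 4 * X ^ 3" if "4 * X ^ 3 = g\<^sup>2 + 27 * ?D * s\<^sup>2" for s X g :: real
    using that by simp
  have A3: "27 * ?D * a\<^sup>2 \<le> 4 * A ^ 3"
    using syzygy[of b a c d] by (intro sA) (simp add: A_def)
  have C3: "27 * ?D * d\<^sup>2 \<le> 4 * C ^ 3"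
    using syzygy[of c d b a] by (intro sA) (simp add: C_def disc_reverse algebra_simps)
  \<comment> \<open>the form in the basis \<open>(1, 0)\<close>, \<open>(-1, 1)\<close>\<close>
  define b' c' where "b' = b - 3 * a" and "c' = c - 2 * b + 3 * a"
  have D': "disc a b' c' w = ?D"
    unfolding disc_def b'_def c'_def wd by algebra
  have A': "b'\<^sup>2 - 3 * a * c' = A"
    unfolding A_def b'_def c'_def by algebra
  have E': "c'\<^sup>2 - 3 * b' * w = E"
    unfolding A_def B_def C_def E_def b'_def c'_def wd by algebra
  have B': "b' * c' - 9 * a * w = B - 2 * A"
    unfolding A_def B_def b'_def c'_def wd by algebra
  have E3: "27 * ?D * w\<^sup>2 \<le> 4 * E ^ 3"
    using syzygy[of c' w b' a] E' D' disc_reverse[of w c' b' a] by (intro sA) (simp add: algebra_simps)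
  have D1: "27 * ?D \<le> 27 * ?D * s\<^sup>2" if "1 \<le> \<bar>s\<bar>" for s
    using mult_left_mono[OF ge1[OF that], of "27 * ?D"] D0 by simp
  have cube: "27/4 \<le> X" if "27 * (X * Y) \<le> 4 * X ^ 3" "X \<le> Y" "0 < X" for X Y :: real
  proof -
    have "27 * (X * X) \<le> 27 * (X * Y)"
      using that by simp
    also have "\<dots> \<le> 4 * X * (X * X)"
      using that(1) by (simp add: power3_eq_cube algebra_simps)
    finally show ?thesis
      using that(3) by simp
  qed
  have AC: "27 * (A * C) \<le> 4 * A ^ 3" "27 * (C * A) \<le> 4 * C ^ 3"
    using A3 C3 D1[of a] D1[of d] a d DAC by (auto simp: algebra_simps)
  have "A \<ge> 27/4 \<and> C \<ge> 27/4"
    using cube[OF AC(1)] cube[OF AC(2)] A0 C0 by linarith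
  then have Al: "A \<ge> 27/4" and Cl: "C \<ge> 27/4"
    by auto
  have "27/4 * (27/4) \<le> A * C"
    using Al Cl by (intro mult_mono) auto
  then have ACl: "729/16 \<le> A * C" by simp
  then have Dl: "?D \<ge> 729/16"
    using DAC by simp
  have AC49: "A * C < 49"
    using DAC D49 by linarith
  have "A * (27/4) \<le> A * C" "27/4 * C \<le> A * C"
    using Al Cl by (auto intro: mult_mono)
  then have Au: "A \<le> 363/50" and Cu: "C \<le> 363/50"
    using AC49 by linarith+
  have "0 \<le> (A - 27/4) * (C - 27/4)"
    using Al Cl by (intro mult_nonneg_nonneg) auto
  then have ApC: "A + C \<le> 1401/100 + 1/100"
    using AC49 by (simp add: algebra_simps)
  have "(59/10)\<^sup>2 \<le> B\<^sup>2"
    using D ACl D49 by (simp add: power2_eq_square)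
  then have Bl: "59/10 \<le> B"
    using B0 by (rule power2_le_imp_le)
  have "B\<^sup>2 \<le> 7\<^sup>2"
    using B2 AC49 by simp
  then have Bu: "B \<le> 7"
    by (rule power2_le_imp_le) simp
  have Eu: "E \<le> 812/100"
    unfolding E_def using ApC Bl by simp
  have A3u: "A ^ 3 \<le> (363/50) ^ 3" and C3u: "C ^ 3 \<le> (363/50) ^ 3"
    using Au Cu Al Cl by (auto intro!: power_mono)
  have El: "E \<ge> 0"
    using BA Cl by (simp add: E_def)
  have E3u: "E ^ 3 \<le> (812/100) ^ 3"
    using Eu El by (rule power_mono)
  \<comment> \<open>\<open>a\<close>, \<open>- d\<close>, \<open>w\<close> have the same sign: the cubic covariant is at most \<open>18\<close> at \<open>(1, 0)\<close>, \<open>(0, 1)\<close>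
    and at most \<open>31\<close> at \<open>(-1, 1)\<close>, too small to outweigh the Hessian term\<close>
  have ad: "a * d < 0"
  proof (rule opposite_signs[of a b c d, folded A_def B_def C_def])
    show "a\<^sup>2 \<ge> 1" "d\<^sup>2 \<ge> 1"
      using a d by (auto intro: ge1)
    show "4 * A ^ 3 - 27 * ?D \<le> 18\<^sup>2" "4 * C ^ 3 - 27 * ?D \<le> 18\<^sup>2"
      using A3u C3u Dl by (simp_all add: power3_eq_cube)
    have "59/10 * (9 * (729/16) - 49) \<le> B * (9 * ?D - B\<^sup>2)"
      using Bl Dl \<open>B\<^sup>2 \<le> 7\<^sup>2\<close> by (intro mult_mono) auto
    also have "\<dots> = 2 * (2 * B * (3 * A * C - B\<^sup>2))"
      using D by algebra
    finally show "18 * 18 < 2 * B * (3 * A * C - B\<^sup>2)"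
      by simp
  qed (use D0 in auto)
  have aw: "a * w > 0"
  proof -
    define T where "T = 2 * A - B"
    have T: "13/2 \<le> T" "T \<le> 863/100"
      using Al Au Bl Bu by (auto simp: T_def)
    have T2: "T\<^sup>2 \<le> (863/100)\<^sup>2"
      using T by (intro power_mono) auto
    have DT: "3 * ?D = 4 * A * E - T\<^sup>2"
      using D unfolding T_def E_def by algebra
    have "2 * (18 * 31) < 13/2 * (9 * (729/16) - (863/100)\<^sup>2 :: real)"
      by (simp add: power2_eq_square)
    also have "13/2 * (9 * (729/16) - (863/100)\<^sup>2) \<le> T * (9 * ?D - T\<^sup>2)"
      using T Dl T2 by (intro mult_mono diff_mono) (simp_all add: power2_eq_square)
    also have "T * (9 * ?D - T\<^sup>2) = 2 * (2 * T * (3 * A * E - T\<^sup>2))"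
      using DT by algebra
    finally have gh: "18 * 31 < 2 * T * (3 * A * E - T\<^sup>2)"
      by linarith
    have "a * (- w) < 0"
    proof (rule opposite_signs[of a "- b'" c' "- w" 18 31])
      have m: "disc a (- b') c' (- w) = ?D" "(- b')\<^sup>2 - 3 * a * c' = A"
         "- b' * c' - 9 * a * (- w) = T" "c'\<^sup>2 - 3 * (- b') * (- w) = E"
        using D' A' B' E' by (simp_all add: disc_def T_def algebra_simps)
      show "disc a (- b') c' (- w) > 0" "a\<^sup>2 \<ge> 1" "(- w)\<^sup>2 \<ge> 1"
        using m D0 a w by (auto intro: ge1)
      show "4 * ((- b')\<^sup>2 - 3 * a * c') ^ 3 - 27 * disc a (- b') c' (- w) \<le> 18\<^sup>2"
        unfolding m using A3u Dl by (simp add: power3_eq_cube)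
      show "4 * (c'\<^sup>2 - 3 * (- b') * (- w)) ^ 3 - 27 * disc a (- b') c' (- w) \<le> 31\<^sup>2"
        unfolding m using E3u Dl by (simp add: power3_eq_cube)
      show "18 * 31 < 2 * (- b' * c' - 9 * a * (- w)) *
         (3 * ((- b')\<^sup>2 - 3 * a * c') * (c'\<^sup>2 - 3 * (- b') * (- w)) - (- b' * c' - 9 * a * (- w))\<^sup>2)"
        unfolding m using gh .
    qed auto
    then show ?thesis by simp
  qed
  define q where "q = - d"
  have q1: "q \<ge> 1"
    using ad a d by (auto simp: q_def mult_less_0_iff)
  have w1: "w \<ge> 1"
    using aw a w by (auto simp: zero_less_mult_iff)
  have up: "s \<le> 4/3" if "27 * ?D * s\<^sup>2 \<le> 4 * X ^ 3" "X ^ 3 \<le> (812/100) ^ 3" for s X :: real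
  proof -
    have "729/16 * s\<^sup>2 \<le> ?D * s\<^sup>2"
      using Dl by (rule mult_right_mono) simp
    then have "s\<^sup>2 \<le> (4/3)\<^sup>2"
      using that by (simp add: power2_eq_square power3_eq_cube)
    then show ?thesis
      by (rule power2_le_imp_le) simp
  qed
  have a2: "a \<le> 4/3" and q2: "q \<le> 4/3" and w2: "w \<le> 4/3"
    using up[OF A3] up[of q C] up[OF E3] A3u C3u E3u C3 by (simp_all add: q_def power3_eq_cube)
  define n where "n = b - (3 * a - q + w) / 2"
  have b: "b = n + (3 * a - q + w) / 2"
    by (simp add: n_def)
  have c: "c = n + (a - 3 * q - w) / 2"
    using wd by (simp add: n_def q_def field_simps)
  have d': "d = - q"
    by (simp add: q_def)
  \<comment> \<open>the values at the long vectors \<open>(1, 1)\<close>, \<open>(1, -2)\<close>, \<open>(-2, 1)\<close>; their pairwise differences are at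
    most \<open>2\<close> and their sum is \<open>6 * n\<close>, so \<open>\<bar>n\<bar> < 1/2\<close> would put one of them strictly between \<open>-1\<close> and \<open>1\<close>\<close>
  have "\<bar>3 * a - 3 * q + 2 * n\<bar> \<ge> 1" "\<bar>3 * q - 3 * w + 2 * n\<bar> \<ge> 1" "\<bar>3 * w - 3 * a + 2 * n\<bar> \<ge> 1"
    using F[of 1 1] F[of 1 "-2"] F[of "-2" 1] unfolding b c d' cubic_def by (auto simp: field_simps)
  then have "\<bar>n\<bar> \<ge> 1/2"
    using a a2 q1 q2 w1 w2 by linarith
  then have "disc a b c d \<ge> 49"
    unfolding b c d' using a a2 q1 q2 w1 w2 by (intro normal_form_bound)
  then show False
    using D49 by simp
qed

text \<open>The form is at least \<open>m\<close> in absolute value at all nonzero integer points.\<close>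
definition integral_ge :: "real \<Rightarrow> real \<Rightarrow> real \<Rightarrow> real \<Rightarrow> real \<Rightarrow> bool"
  where "integral_ge m a b c d \<longleftrightarrow>
    (\<forall>x y :: int. (x, y) \<noteq> (0, 0) \<longrightarrow> m \<le> \<bar>cubic a b c d (of_int x) (of_int y)\<bar>)"

lemma reduced_bound:
  fixes a b c d :: real
  assumes D0: "disc a b c d > 0" and F: "integral_ge 1 a b c d"
    and BA: "\<bar>b * c - 9 * a * d\<bar> \<le> b\<^sup>2 - 3 * a * c" and BC: "\<bar>b * c - 9 * a * d\<bar> \<le> c\<^sup>2 - 3 * b * d"
  shows "disc a b c d \<ge> 49"
proof -
  have *: "disc a b c d \<ge> 49" if "disc a b c d > 0" "integral_ge 1 a b c d" "a > 0"
    "\<bar>b * c - 9 * a * d\<bar> \<le> b\<^sup>2 - 3 * a * c" "\<bar>b * c - 9 * a * d\<bar> \<le> c\<^sup>2 - 3 * b * d" 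
     "b * c - 9 * a * d \<ge> 0" for a b c d
  proof -
    have "a \<ge> 1"
      using that(2)[unfolded integral_ge_def, rule_format, of 1 0] that(3) by (simp add: cubic_def)
    then show ?thesis
      using that by (intro reduced_bound_aux) (auto simp: integral_ge_def)
  qed
  have **: "disc a b c d \<ge> 49" if "disc a b c d > 0" "integral_ge 1 a b c d" "a > 0"
    "\<bar>b * c - 9 * a * d\<bar> \<le> b\<^sup>2 - 3 * a * c" "\<bar>b * c - 9 * a * d\<bar> \<le> c\<^sup>2 - 3 * b * d" for a b c d
  proof (cases "b * c - 9 * a * d \<ge> 0")
    case False
    \<comment> \<open>replace \<open>y\<close> by \<open>-y\<close>\<close>
    have "integral_ge 1 a (- b) c (- d)"
      unfolding integral_ge_def
    proof (intro allI impI)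
      fix x y :: int assume "(x, y) \<noteq> (0, 0)"
      then show "1 \<le> \<bar>cubic a (- b) c (- d) (of_int x) (of_int y)\<bar>"
        using that(2)[unfolded integral_ge_def, rule_format, of x "- y"] by (simp add: cubic_def)
    qed
    moreover have "disc a (- b) c (- d) = disc a b c d"
      by (simp add: disc_def)
    ultimately show ?thesis
      using *[of a "- b" c "- d"] that False by simp
  qed (use * that in blast)
  have "\<bar>a\<bar> \<ge> 1"
    using F[unfolded integral_ge_def, rule_format, of 1 0] by (simp add: cubic_def)
  then consider "a > 0" | "a < 0" by linarith
  then show ?thesis
  proof cases
    case 2
    have "cubic (- a) (- b) (- c) (- d) x y = - cubic a b c d x y" for x y
      by (simp add: cubic_def)
    then have "integral_ge 1 (- a) (- b) (- c) (- d)"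
      using F by (simp add: integral_ge_def)
    moreover have "disc (- a) (- b) (- c) (- d) = disc a b c d"
      by (simp add: disc_def)
    ultimately show ?thesis
      using **[of "- a" "- b" "- c" "- d"] assms 2 by simp
  qed (use ** assms in blast)
qed

section \<open>Reduction of the Hessian and the upper bound\<close>

lemma finite_hess_le:
  assumes D: "disc a b c d > 0" and A: "b\<^sup>2 - 3 * a * c > 0" and C: "c\<^sup>2 - 3 * b * d > 0"
  shows "finite {(x, y). hess a b c d (real_of_int x) (real_of_int y) \<le> K}"
proof -
  define A B C where ABC: "A = b\<^sup>2 - 3 * a * c" "B = b * c - 9 * a * d" "C = c\<^sup>2 - 3 * b * d"
  have D': "3 * disc a b c d = 4 * A * C - B\<^sup>2"
    unfolding ABC by (rule disc_hess)
  have bd: "\<bar>s\<bar> \<le> \<lceil>r\<rceil>" if "of_int s ^ 2 \<le> r" for s :: int and r :: real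
  proof -
    have "\<bar>s\<bar> \<le> s\<^sup>2"
      using self_le_power[of "\<bar>s\<bar>" 2] by (cases "s = 0") auto
    moreover have "s\<^sup>2 \<le> \<lceil>r\<rceil>"
      using that by (metis ceiling_mono ceiling_of_int of_int_power)
    ultimately show ?thesis by linarith
  qed
  define r where "r = \<bar>\<lceil>4 * A * K / (3 * disc a b c d)\<rceil>\<bar> + \<bar>\<lceil>4 * C * K / (3 * disc a b c d)\<rceil>\<bar>"
  have "{(x, y). hess a b c d (real_of_int x) (real_of_int y) \<le> K} \<subseteq> {-r..r} \<times> {-r..r}"
  proof safe
    fix x y :: int
    assume h: "hess a b c d (of_int x) (of_int y) \<le> K"
    let ?x = "real_of_int x" and ?y = "real_of_int y"
    have "4 * A * hess a b c d ?x ?y = (2 * A * ?x + B * ?y)\<^sup>2 + 3 * disc a b c d * ?y\<^sup>2"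
      unfolding D' hess_def ABC[symmetric] by algebra
    moreover have "4 * A * hess a b c d ?x ?y \<le> 4 * A * K"
      using h A ABC by simp
    ultimately have "3 * disc a b c d * ?y\<^sup>2 \<le> 4 * A * K"
      by (smt (verit) zero_le_power2)
    then have "?y\<^sup>2 \<le> 4 * A * K / (3 * disc a b c d)"
      using D by (simp add: field_simps)
    from bd[OF this] have y: "\<bar>y\<bar> \<le> r"
      by (simp add: r_def)
    have "4 * C * hess a b c d ?x ?y = (2 * C * ?y + B * ?x)\<^sup>2 + 3 * disc a b c d * ?x\<^sup>2"
      unfolding D' hess_def ABC[symmetric] by algebra
    moreover have "4 * C * hess a b c d ?x ?y \<le> 4 * C * K"
      using h C ABC by simp
    ultimately have "3 * disc a b c d * ?x\<^sup>2 \<le> 4 * C * K"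
      by (smt (verit) zero_le_power2)
    then have "?x\<^sup>2 \<le> 4 * C * K / (3 * disc a b c d)"
      using D by (simp add: field_simps)
    from bd[OF this] have x: "\<bar>x\<bar> \<le> r"
      by (simp add: r_def)
    show "x \<in> {-r..r}" "y \<in> {-r..r}"
      using x y by auto
  qed
  then show ?thesis
    by (rule finite_subset) auto
qed

text \<open>
  Gauss reduction: among all integral bases \<open>v\<close>, \<open>w\<close> of determinant \<open>1\<close> choose one that minimises the sum
  of the Hessians at \<open>v\<close> and \<open>w\<close>. Comparing with \<open>v\<close>, \<open>w \<plusminus> v\<close> and with \<open>v \<plusminus> w\<close>, \<open>w\<close> shows that it is reduced.
\<close>
lemma reduction:
  fixes a b c d :: real
  assumes D0: "disc a b c d > 0" and F: "integral_ge m a b c d" and m: "m > 0"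
  obtains a' b' c' d' where "disc a' b' c' d' = disc a b c d" "integral_ge m a' b' c' d'"
    "\<bar>b' * c' - 9 * a' * d'\<bar> \<le> b'\<^sup>2 - 3 * a' * c'" "\<bar>b' * c' - 9 * a' * d'\<bar> \<le> c'\<^sup>2 - 3 * b' * d'"
proof -
  have nz: "a \<noteq> 0" "d \<noteq> 0"
    using F[unfolded integral_ge_def, rule_format, of 1 0]
      F[unfolded integral_ge_def, rule_format, of 0 1] m by (auto simp: cubic_def)
  have A: "b\<^sup>2 - 3 * a * c > 0" and C: "c\<^sup>2 - 3 * b * d > 0"
    using hess_pos[OF D0 nz(1)] hess_pos[of d c b a] nz D0 by (auto simp: disc_reverse algebra_simps)
  define h where "h v = hess a b c d (of_int (fst v)) (of_int (snd v))" for v :: "int \<times> int"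
  have h0: "h v \<ge> 0" for v
  proof -
    have "4 * (b\<^sup>2 - 3 * a * c) * h v = (2 * (b\<^sup>2 - 3 * a * c) * of_int (fst v)
        + (b * c - 9 * a * d) * of_int (snd v))\<^sup>2 + 3 * disc a b c d * (of_int (snd v))\<^sup>2"
      unfolding disc_hess h_def hess_def by algebra
    also have "\<dots> \<ge> 0"
      using D0 by simp
    finally show ?thesis
      using A by (simp add: zero_le_mult_iff)
  qed
  define K where "K = h (1, 0) + h (0, 1)"
  define S where "S = {(v, w).
      fst v * snd w - fst w * snd v = 1 \<and> h v + h w \<le> K}"
  have "S \<subseteq> {v. h v \<le> K} \<times> {v. h v \<le> K}"
  proof (intro subrelI SigmaI CollectI)
    fix v w assume "(v, w) \<in> S"
    then have "h v + h w \<le> K" by (simp add: S_def)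
    then show "h v \<le> K" "h w \<le> K"
      using h0[of v] h0[of w] by linarith+
  qed
  moreover have "finite {v. h v \<le> K}"
    using finite_hess_le[OF D0 A C, of K] by (simp add: h_def case_prod_beta')
  ultimately have fin: "finite S"
    using finite_subset by blast
  have "((1, 0), (0, 1)) \<in> S"
    by (simp add: S_def K_def)
  then have ne: "S \<noteq> {}" by blast
  obtain v w where am: "arg_min_on (\<lambda>(v, w). h v + h w) S = (v, w)"
    by (meson surj_pair)
  have vw: "(v, w) \<in> S" and min: "\<And>v' w'. (v', w') \<in> S \<Longrightarrow> h v + h w \<le> h v' + h w'"
    using arg_min_if_finite[OF fin ne, of "\<lambda>(v, w). h v + h w"] unfolding am
    by (auto simp: not_less)
  obtain r t where v: "v = (r, t)" by fastforce
  obtain s u where w: "w = (s, u)" by fastforce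
  have det: "r * u - s * t = 1" and K: "h v + h w \<le> K"
    using vw by (auto simp: S_def v w)
  have detr: "real_of_int r * of_int u - of_int s * of_int t = 1"
    using det by (metis of_int_1 of_int_diff of_int_mult)
  obtain a' b' c' d' where G':
    "\<And>x y. cubic a' b' c' d' x y = cubic a b c d (of_int r * x + of_int s * y) (of_int t * x + of_int u * y)"
    "\<And>x y. hess a' b' c' d' x y = (real_of_int r * of_int u - of_int s * of_int t)\<^sup>2 *
       hess a b c d (of_int r * x + of_int s * y) (of_int t * x + of_int u * y)"
    "disc a' b' c' d' = (real_of_int r * of_int u - of_int s * of_int t) ^ 6 * disc a b c d"
    using cubic_subst[of a b c d "of_int r" "of_int s" "of_int t" "of_int u"] by blast
  note G = G'[unfolded detr, simplified]
  have hG: "hess a' b' c' d' x y = h (r * x + s * y, t * x + u * y)" for x y :: int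
    by (simp add: G h_def)
  have F': "integral_ge m a' b' c' d'"
    unfolding integral_ge_def
  proof (intro allI impI)
    fix x y :: int
    assume nz: "(x, y) \<noteq> (0, 0)"
    have "u * (r * x + s * y) - s * (t * x + u * y) = x" "r * (t * x + u * y) - t * (r * x + s * y) = y"
      using det by algebra+
    then have "(r * x + s * y, t * x + u * y) \<noteq> (0, 0)"
      using nz by auto
    then show "m \<le> \<bar>cubic a' b' c' d' (of_int x) (of_int y)\<bar>"
      using F[unfolded integral_ge_def, rule_format, of "r * x + s * y" "t * x + u * y"] by (simp add: G)
  qed
  have shear: "h v + h w \<le> h v' + h w'" if "fst v' * snd w' - fst w' * snd v' = 1" for v' w'
    using min[of v' w'] that K by (cases "h v' + h w' \<le> K") (auto simp: S_def)
  have hv: "h v = hess a' b' c' d' 1 0" and hw: "h w = hess a' b' c' d' 0 1"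
    using hG[of 1 0] hG[of 0 1] by (simp_all add: v w)
  have "h v + h w \<le> h v + h (r * e + s * 1, t * e + u * 1)" if "e = 1 \<or> e = -1" for e
    using that det by (intro shear) (auto simp: v algebra_simps)
  from this[of 1] this[of "-1"]
  have 1: "\<bar>b' * c' - 9 * a' * d'\<bar> \<le> b'\<^sup>2 - 3 * a' * c'"
    unfolding hG[symmetric] hw by (simp add: hess_def abs_le_iff)
  have "h v + h w \<le> h (r * 1 + s * e, t * 1 + u * e) + h w" if "e = 1 \<or> e = -1" for e
    using that det by (intro shear) (auto simp: w algebra_simps)
  from this[of 1] this[of "-1"]
  have 2: "\<bar>b' * c' - 9 * a' * d'\<bar> \<le> c'\<^sup>2 - 3 * b' * d'"
    unfolding hG[symmetric] hv by (simp add: hess_def abs_le_iff)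
  show thesis
    using that G(3) F' 1 2 by blast
qed

lemma minimum_bound:
  assumes D: "disc a b c d > 0" and F: "integral_ge m a b c d" and m: "m \<ge> 0"
  shows "49 * m ^ 4 \<le> disc a b c d"
proof (cases "m = 0")
  case False
  then have m: "m > 0" using m by simp
  have dm: "disc (a / m) (b / m) (c / m) (d / m) = disc a b c d / m ^ 4"
    using m unfolding disc_def by (simp add: field_simps eval_nat_numeral)
  have cm: "cubic (a / m) (b / m) (c / m) (d / m) x y = cubic a b c d x y / m" for x y
    by (simp add: cubic_def add_divide_distrib)
  have F1: "integral_ge 1 (a / m) (b / m) (c / m) (d / m)"
    using F m by (simp add: integral_ge_def cm abs_divide le_divide_eq)
  have D1: "disc (a / m) (b / m) (c / m) (d / m) > 0"
    using D m by (simp add: dm)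
  obtain a' b' c' d' where
    "disc a' b' c' d' = disc (a / m) (b / m) (c / m) (d / m)" "integral_ge 1 a' b' c' d'"
    "\<bar>b' * c' - 9 * a' * d'\<bar> \<le> b'\<^sup>2 - 3 * a' * c'" "\<bar>b' * c' - 9 * a' * d'\<bar> \<le> c'\<^sup>2 - 3 * b' * d'"
    by (rule reduction[OF D1 F1 zero_less_one])
  then have "49 \<le> disc a b c d / m ^ 4"
    using reduced_bound[of a' b' c' d'] D1 dm by simp
  then show ?thesis
    using m by (simp add: field_simps)
qed (use D in simp)

section \<open>Moving one root of a cubic form\<close>

lemma sqrt2_badly_approximable:
  fixes u w m :: int
  assumes "w \<noteq> 0"
  shows "\<bar>of_int u - of_int w * (of_int m + sqrt 2)\<bar> \<ge> 1 / (4 * \<bar>of_int w\<bar>)"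
proof -
  define v where "v = u - w * m"
  define \<delta> where "\<delta> = \<bar>of_int v - of_int w * sqrt 2\<bar>"
  have eq: "\<bar>of_int u - of_int w * (of_int m + sqrt 2)\<bar> = \<delta>"
    by (simp add: \<delta>_def v_def algebra_simps)
  have w: "\<bar>real_of_int w\<bar> \<ge> 1"
    using assms by linarith
  have s: "sqrt 2 \<le> 3 / 2"
    by (rule real_le_lsqrt) (auto simp: power2_eq_square)
  show ?thesis
  proof (cases "\<delta> < 1")
    case False
    have "1 / (4 * \<bar>real_of_int w\<bar>) \<le> 1"
      using w by simp
    then show ?thesis
      using False unfolding eq by linarith
  next
    case True
    have "v\<^sup>2 \<noteq> 2 * w\<^sup>2"
    proof
      assume "v\<^sup>2 = 2 * w\<^sup>2"
      then have "multiplicity 2 (v\<^sup>2) = multiplicity 2 (2 * w\<^sup>2)" by simp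
      moreover have "v \<noteq> 0" using \<open>v\<^sup>2 = 2 * w\<^sup>2\<close> assms by auto
      ultimately have "2 * multiplicity 2 v = Suc (2 * multiplicity 2 w)"
        using assms by (simp add: prime_elem_multiplicity_power_distrib prime_elem_multiplicity_mult_distrib)
      then show False by presburger
    qed
    then have "\<bar>v\<^sup>2 - 2 * w\<^sup>2\<bar> \<ge> 1"
      by linarith
    then have "1 \<le> \<bar>real_of_int (v\<^sup>2 - 2 * w\<^sup>2)\<bar>"
      by linarith
    also have "real_of_int (v\<^sup>2 - 2 * w\<^sup>2) = (of_int v - of_int w * sqrt 2) * (of_int v + of_int w * sqrt 2)"
      by (simp add: algebra_simps power2_eq_square)
    finally have 1: "1 \<le> \<delta> * \<bar>of_int v + of_int w * sqrt 2\<bar>"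
      by (simp add: \<delta>_def abs_mult)
    have "\<bar>of_int v + of_int w * sqrt 2\<bar> \<le> \<delta> + 2 * \<bar>of_int w * sqrt 2\<bar>"
      unfolding \<delta>_def by linarith
    also have "\<bar>of_int w * sqrt 2\<bar> \<le> \<bar>of_int w\<bar> * (3 / 2)"
      using mult_left_mono[OF s, of "\<bar>of_int w\<bar>"] by (simp add: abs_mult)
    finally have "\<bar>of_int v + of_int w * sqrt 2\<bar> \<le> 4 * \<bar>of_int w\<bar>"
      using True w by linarith
    then have "\<delta> * \<bar>of_int v + of_int w * sqrt 2\<bar> \<le> \<delta> * (4 * \<bar>of_int w\<bar>)"
      by (rule mult_left_mono) (simp add: \<delta>_def)
    then show ?thesis
      using 1 w unfolding eq by (simp add: field_simps)
  qed
qed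

lemma dirichlet_large_denominator:
  fixes \<beta> Q :: real
  assumes "\<beta> \<notin> \<rat>"
  obtains p q :: int where "coprime p q" "q > 0" "of_int q \<ge> Q" "\<bar>\<beta> - p / q\<bar> < 1 / (of_int q)\<^sup>2"
proof -
  have inf: "infinite (approx_set \<beta>)"
    using assms rational_iff_finite_approx_set by blast
  define N where "N = \<lceil>\<bar>Q\<bar>\<rceil>"
  have "\<exists>(p, q)\<in>approx_set \<beta>. q > N"
  proof (rule ccontr)
    assume "\<not> ?thesis"
    then have le: "q \<le> N" if "(p, q) \<in> approx_set \<beta>" for p q
      using that by fastforce
    define K where "K = \<lceil>\<bar>\<beta>\<bar> * \<bar>of_int N\<bar>\<rceil> + 1"
    have "approx_set \<beta> \<subseteq> {-K..K} \<times> {0..N}"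
    proof (rule subrelI)
      fix p q assume pq: "(p, q) \<in> approx_set \<beta>"
      then have q: "q > 0" "q \<le> N" and b: "\<bar>\<beta> - p / q\<bar> < 1 / (of_int q)\<^sup>2"
        using le by (auto simp: approx_set_def)
      have "real_of_int q \<ge> 1" using q by linarith
      have "\<bar>\<beta> * q - p\<bar> = \<bar>\<beta> - p / q\<bar> * q"
        using q by (simp add: abs_mult[symmetric] field_simps flip: abs_mult_pos)
      also have "\<dots> \<le> 1 / (of_int q)\<^sup>2 * q"
        using b q by (intro mult_right_mono) auto
      also have "\<dots> \<le> 1"
        using \<open>real_of_int q \<ge> 1\<close> by (simp add: power2_eq_square)
      finally have "\<bar>\<beta> * q - p\<bar> \<le> 1" .
      moreover have "\<bar>\<beta> * q\<bar> \<le> \<bar>\<beta>\<bar> * \<bar>of_int N\<bar>"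
        using q by (simp add: abs_mult mult_left_mono)
      ultimately have "\<bar>real_of_int p\<bar> \<le> \<bar>\<beta>\<bar> * \<bar>of_int N\<bar> + 1"
        by linarith
      then have "\<bar>p\<bar> \<le> K"
        unfolding K_def by linarith
      then show "(p, q) \<in> {-K..K} \<times> {0..N}"
        using q by auto
    qed
    then show False
      using inf finite_subset by blast
  qed
  then obtain p q where pq: "(p, q) \<in> approx_set \<beta>" "q > N" by blast
  have "of_int q \<ge> Q"
    using pq(2) unfolding N_def by linarith
  then show thesis
    using pq that by (auto simp: approx_set_def)
qed

text \<open>
  Here \<open>g b x y\<close> stands for the absolute value of the form with the roots \<open>\<alpha>\<close>, \<open>b\<close>, \<open>\<gamma>\<close>, scaled by \<open>c b\<close>.
  With \<open>p/q\<close> close to \<open>\<beta>\<close> and a matrix \<open>(p p'; q q')\<close> of determinant \<open>1\<close>, the new root is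
  \<open>b = (p \<omega> + p') / (q \<omega> + q')\<close> with \<open>\<omega> = m + \<surd>2\<close>. If \<open>x = p u + p' w\<close> and \<open>y = q u + q' w\<close>, then
  \<open>\<bar>x - b y\<bar> = \<bar>u - w \<omega>\<bar> / D\<close> with \<open>D = q \<omega> + q'\<close>. The integer \<open>m\<close> is used to tune \<open>D\<close>, which has size
  \<open>q\<^sup>2\<close> and can be changed in steps of \<open>q\<close>, so that the value at \<open>(p, q)\<close> is nearly \<open>t\<close>.
\<close>
lemma perturb_root:
  fixes \<alpha> \<beta> \<gamma> t T \<epsilon> \<eta> :: real and c :: "real \<Rightarrow> real"
  defines "g \<equiv> (\<lambda>b x y. c b * \<bar>x - \<alpha> * y\<bar> * \<bar>x - \<gamma> * y\<bar> * \<bar>x - b * y\<bar>)"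
  assumes t: "0 < t" "t < T" and \<epsilon>: "\<epsilon> > 0" and \<eta>: "\<eta> > 0"
    and c: "isCont c \<beta>" "c \<beta> > 0" and ne: "\<beta> \<noteq> \<alpha>" "\<beta> \<noteq> \<gamma>"
    and T: "\<And>(x::int) (y::int). (x, y) \<noteq> (0::int, 0::int) \<Longrightarrow> T \<le> g \<beta> x y"
  shows "\<exists>b. \<bar>b - \<beta>\<bar> < \<eta> \<and> (\<forall>(x::int) (y::int). (x, y) \<noteq> (0::int, 0::int) \<longrightarrow> t \<le> g b x y) \<and>
           (\<exists>(x::int) (y::int). (x, y) \<noteq> (0::int, 0::int) \<and> g b x y \<le> t + \<epsilon>)"
proof -
  have irr: "\<beta> \<notin> \<rat>"
  proof
    assume "\<beta> \<in> \<rat>"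
    then obtain x y :: int where "y > 0" "\<beta> = of_int x / of_int y"
      by (elim Rats_cases') 
    then have "g \<beta> x y = 0"
      by (simp add: g_def)
    then show False
      using T[of x y] \<open>y > 0\<close> t by auto
  qed
  define \<rho> where "\<rho> = min \<bar>\<beta> - \<alpha>\<bar> \<bar>\<beta> - \<gamma>\<bar>"
  have \<rho>: "\<rho> > 0" "\<bar>\<beta> - \<alpha>\<bar> \<ge> \<rho>" "\<bar>\<beta> - \<gamma>\<bar> \<ge> \<rho>"
    using ne by (auto simp: \<rho>_def)
  \<comment> \<open>\<open>\<kappa>\<close> bounds the relative error of the scaling factor, and of \<open>x - b y\<close> far from the line \<open>x = \<beta> y\<close>\<close>
  have "((\<lambda>\<kappa>. (1 - \<kappa>)\<^sup>2 * T) \<longlongrightarrow> (1 - 0)\<^sup>2 * T) (at_right 0)"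
    by (intro tendsto_intros)
  then have e1: "\<forall>\<^sub>F \<kappa> in at_right 0. t < (1 - \<kappa>)\<^sup>2 * T"
    by (rule order_tendstoD) (use t in simp)
  have "((\<lambda>\<kappa>. t * (1 + \<kappa>) - (t + \<epsilon>) * (1 - \<kappa>)) \<longlongrightarrow> t * (1 + 0) - (t + \<epsilon>) * (1 - 0)) (at_right 0)"
    by (intro tendsto_intros)
  then have e2: "\<forall>\<^sub>F \<kappa> in at_right 0. t * (1 + \<kappa>) - (t + \<epsilon>) * (1 - \<kappa>) < 0"
    by (rule order_tendstoD) (use \<epsilon> in simp)
  have e3: "\<forall>\<^sub>F \<kappa> :: real in at_right 0. 0 < \<kappa> \<and> \<kappa> < 1"
    by (rule eventually_conj[OF eventually_at_right_less]) (auto simp: eventually_at_right_field intro!: exI[of _ 1])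
  obtain \<kappa> where \<kappa>: "0 < \<kappa>" "\<kappa> < 1" and \<kappa>T: "t < (1 - \<kappa>)\<^sup>2 * T"
    and \<kappa>\<epsilon>: "t * (1 + \<kappa>) - (t + \<epsilon>) * (1 - \<kappa>) < 0"
    using eventually_happens'[OF _ eventually_conj[OF e1 eventually_conj[OF e2 e3]]] by auto
  define l where "l = t / (1 - \<kappa>)"
  define r where "r = (t + \<epsilon>) / (1 + \<kappa>)"
  have lr: "0 < l" "l < r"
    using \<kappa>\<epsilon> \<kappa> t unfolding l_def r_def by (auto simp: field_simps)
  have "\<forall>\<^sub>F b in nhds \<beta>. \<bar>c b - c \<beta>\<bar> < \<kappa> * c \<beta>"
    using c \<kappa> unfolding isCont_def tendsto_at_iff_tendsto_nhds
    by (auto dest!: tendstoD[of _ _ _ "\<kappa> * c \<beta>"] simp: dist_real_def)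
  then obtain \<eta>1 where \<eta>1: "\<eta>1 > 0" "\<And>b. \<bar>b - \<beta>\<bar> < \<eta>1 \<Longrightarrow> \<bar>c b - c \<beta>\<bar> < \<kappa> * c \<beta>"
    unfolding eventually_nhds_metric dist_real_def by blast
  define \<eta>2 where "\<eta>2 = min \<eta> \<eta>1"
  have \<eta>2: "\<eta>2 > 0" "\<eta>2 \<le> \<eta>" "\<eta>2 \<le> \<eta>1"
    using \<eta> \<eta>1 by (auto simp: \<eta>2_def)
  define k where "k = c \<beta> * (\<rho>\<^sup>2 / 4)"
  have k: "k > 0"
    using c \<rho> by (simp add: k_def)
  have big: "\<exists>Q. \<forall>q\<ge>Q. A \<le> B * q" if "B > 0" for A B :: real
    using that by (intro exI[of _ "A / B"]) (auto simp: field_simps)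
  \<comment> \<open>near the line \<open>x = \<beta> y\<close>, integer points that are no multiples of \<open>(p, q)\<close> will satisfy \<open>\<bar>y\<bar> \<ge> q / M\<close>\<close>
  define M where "M = 2 / \<kappa> + 1"
  have M: "M > 0" using \<kappa> by (simp add: M_def add_pos_pos)
  obtain Q where Q: "Q > 0" and
    Q1: "\<And>q. q \<ge> Q \<Longrightarrow> 2 < \<eta>2 * q" and
    Q2: "\<And>q. q \<ge> Q \<Longrightarrow> 1 \<le> k * (1 / l - 1 / r) * q" and
    Q3: "\<And>q. q \<ge> Q \<Longrightarrow> 1 \<le> k / r * q" and
    Q4: "\<And>q. q \<ge> Q \<Longrightarrow> 2 * M \<le> \<rho> * q" and
    Q5: "\<And>q. q \<ge> Q \<Longrightarrow> t \<le> (1 - \<kappa>) * k * (1 / (2 * M\<^sup>2)) * q" and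
    Q6: "\<And>q. q \<ge> Q \<Longrightarrow> t \<le> (1 - \<kappa>) * k * (1 / (8 * M)) * q"
  proof -
    have "\<forall>\<^sub>F q in at_top. A \<le> B * q" if "B > 0" for A B :: real
      using big[OF that] unfolding eventually_at_top_linorder by blast
    note ev = this
    have "1 / l - 1 / r > 0"
      using lr by (simp add: field_simps)
    then have "\<forall>\<^sub>F q :: real in at_top. 1 \<le> 1 * q \<and> 3 \<le> \<eta>2 * q \<and> 1 \<le> k * (1 / l - 1 / r) * q \<and> 1 \<le> k / r * q \<and>
        2 * M \<le> \<rho> * q \<and> t \<le> (1 - \<kappa>) * k * (1 / (2 * M\<^sup>2)) * q \<and> t \<le> (1 - \<kappa>) * k * (1 / (8 * M)) * q"
      using lr k \<kappa> M \<rho> \<eta>2 by (intro eventually_conj ev mult_pos_pos) auto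
    then obtain Q where "\<And>q. q \<ge> Q \<Longrightarrow> 1 \<le> 1 * q \<and> 3 \<le> \<eta>2 * q \<and> 1 \<le> k * (1 / l - 1 / r) * q \<and> 1 \<le> k / r * q \<and>
        2 * M \<le> \<rho> * q \<and> t \<le> (1 - \<kappa>) * k * (1 / (2 * M\<^sup>2)) * q \<and> t \<le> (1 - \<kappa>) * k * (1 / (8 * M)) * q"
      unfolding eventually_at_top_linorder by blast
    then show thesis
      by (intro that[of "max Q 1"]) force+
  qed
  obtain p q0 :: int where cop: "coprime p q0" and q0: "q0 > 0" and qQ: "of_int q0 \<ge> Q"
    and pq: "\<bar>\<beta> - p / q0\<bar> < 1 / (of_int q0)\<^sup>2"
    by (rule dirichlet_large_denominator[OF irr, of Q])
  define q where "q = real_of_int q0"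
  have q1: "q \<ge> 1" using q0 by (simp add: q_def)
  note Qs = Q1[OF qQ, folded q_def] Q2[OF qQ, folded q_def] Q3[OF qQ, folded q_def]
    Q4[OF qQ, folded q_def] Q5[OF qQ, folded q_def] Q6[OF qQ, folded q_def]
  have pq: "\<bar>\<beta> - p / q\<bar> < 1 / q\<^sup>2"
    using pq by (simp add: q_def)
  have qq: "1 / q\<^sup>2 \<le> 1 / q"
    using q1 by (simp add: power2_eq_square divide_simps)
  obtain u v :: int where "u * p + v * q0 = gcd p q0"
    using bezout_int by blast
  then have "p * u - (- v) * q0 = 1"
    using cop by (simp add: algebra_simps)
  then obtain p' q' :: int where bez: "p * q' - p' * q0 = 1"
    by blast
  define h where "h = \<bar>p - \<alpha> * q\<bar> * \<bar>p - \<gamma> * q\<bar>"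
  have Mq: "M / q\<^sup>2 \<le> \<rho> / 2"
  proof -
    have "M / q\<^sup>2 \<le> M / q"
      using mult_left_mono[OF qq, of M] M by simp
    also have "\<dots> \<le> \<rho> / 2"
      using Qs(4) q1 by (simp add: field_simps)
    finally show ?thesis .
  qed
  have M1: "M \<ge> 1" using \<kappa> by (simp add: M_def)
  have hge: "h \<ge> \<rho>\<^sup>2 / 4 * q\<^sup>2"
  proof -
    have *: "q * (\<rho> / 2) \<le> \<bar>p - z * q\<bar>" if "\<bar>\<beta> - z\<bar> \<ge> \<rho>" for z :: real
    proof -
      have "1 / q\<^sup>2 \<le> \<rho> / 2"
        using Mq M1 q1 by (smt (verit) divide_right_mono zero_le_power2)
      then have "\<rho> / 2 \<le> \<bar>p / q - z\<bar>"
        using that pq by linarith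
      then have "q * (\<rho> / 2) \<le> q * \<bar>p / q - z\<bar>"
        using q1 by (intro mult_left_mono) auto
      also have "\<dots> = \<bar>q * (p / q - z)\<bar>"
        using q1 by (simp add: abs_mult)
      also have "q * (p / q - z) = p - z * q"
        using q1 by (simp add: field_simps)
      finally show ?thesis .
    qed
    have "q * (\<rho> / 2) * (q * (\<rho> / 2)) \<le> h"
      unfolding h_def using * \<rho> q1 by (intro mult_mono) auto
    then show ?thesis
      by (simp add: power2_eq_square algebra_simps)
  qed
  have ckh: "k * q * q \<le> c \<beta> * h"
    using mult_left_mono[OF hge, of "c \<beta>"] c by (simp add: k_def power2_eq_square algebra_simps)
  \<comment> \<open>for \<open>D\<close> in \<open>[lo, hi]\<close> the value at \<open>(p, q)\<close> lies in \<open>[t, t + \<epsilon>]\<close>\<close>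
  define lo where "lo = c \<beta> * h / r"
  define hi where "hi = c \<beta> * h / l"
  have lohi: "lo + q \<le> hi" "q \<le> lo"
  proof -
    have "q * 1 \<le> q * (k * (1 / l - 1 / r) * q)"
      using Qs(2) q1 by (intro mult_left_mono) auto
    also have "\<dots> = (k * q * q) * (1 / l - 1 / r)"
      by simp
    also have "\<dots> \<le> (c \<beta> * h) * (1 / l - 1 / r)"
      using ckh lr by (intro mult_right_mono) (auto simp: field_simps)
    also have "\<dots> = hi - lo"
      by (simp add: hi_def lo_def algebra_simps)
    finally show "lo + q \<le> hi" by simp
    have "q * 1 \<le> q * (k / r * q)"
      using Qs(3) q1 by (intro mult_left_mono) auto
    also have "\<dots> = (k * q * q) / r"
      by simp
    also have "\<dots> \<le> lo"
      unfolding lo_def using ckh lr by (intro divide_right_mono) auto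
    finally show "q \<le> lo" by simp
  qed
  have lo0: "lo > 0" using lohi(2) q1 by linarith
  define m where "m = \<lceil>(lo - q') / q - sqrt 2\<rceil>"
  define \<omega> where "\<omega> = m + sqrt 2"
  define D where "D = q * \<omega> + q'"
  have D: "lo \<le> D" "D \<le> hi"
  proof -
    have "(lo - q') / q \<le> \<omega>" "\<omega> \<le> (lo - q') / q + 1"
      unfolding \<omega>_def m_def by linarith+
    then have "lo - q' \<le> \<omega> * q" "\<omega> * q \<le> lo - q' + q"
      using q1 by (simp_all add: field_simps)
    then show "lo \<le> D" "D \<le> hi"
      unfolding D_def using lohi by (simp_all add: mult.commute)
  qed
  have D1: "D \<ge> q" using D lohi by linarith
  have D0: "D > 0" using D1 q1 by linarith
  have bezr: "p * real_of_int q' - p' * q = 1"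
    unfolding q_def using bez by (metis of_int_1 of_int_diff of_int_mult)
  define b where "b = (p * \<omega> + p') / D"
  have bp: "b - p / q = - 1 / (q * D)"
  proof -
    have "b - p / q = ((p * \<omega> + p') * q - p * D) / (q * D)"
      using D0 q1 by (simp add: b_def field_simps)
    also have "(p * \<omega> + p') * q - p * D = - 1"
      using bezr unfolding D_def by algebra
    finally show ?thesis .
  qed
  have bb: "\<bar>b - \<beta>\<bar> < 2 / q\<^sup>2"
  proof -
    have "\<bar>b - p / q\<bar> = 1 / (q * D)"
      unfolding bp using q1 D0 by simp
    also have "\<dots> \<le> 1 / q\<^sup>2"
      unfolding power2_eq_square using q1 D1 D0 by (intro divide_left_mono mult_mono) auto
    finally show ?thesis
      using pq by linarith
  qed
  have b\<eta>: "\<bar>b - \<beta>\<bar> < \<eta>2"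
  proof -
    have "2 / q\<^sup>2 \<le> 2 / q"
      using qq by simp
    also have "\<dots> < \<eta>2"
      using Qs(1) q1 by (simp add: field_simps)
    finally show ?thesis using bb by linarith
  qed
  have cb: "(1 - \<kappa>) * c \<beta> \<le> c b" "c b \<le> (1 + \<kappa>) * c \<beta>"
    using \<eta>1(2)[of b] b\<eta> \<eta>2 by (auto simp: algebra_simps)
  have cb0: "c b > 0"
    using cb(1) c \<kappa> by (smt (verit) mult_pos_pos)
  have lin: "\<bar>x - b * y\<bar> = \<bar>of_int u - of_int w * \<omega>\<bar> / D"
    if "u = q' * x - p' * y" "w = p * y - q0 * x" for x y u w :: int
  proof -
    have "b * D = p * \<omega> + p'"
      using D0 by (simp add: b_def)
    then have "(x - b * y) * D = x * D - (p * \<omega> + p') * y"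
      by algebra
    also have "\<dots> = of_int u - of_int w * \<omega>"
      unfolding D_def that q_def by (simp add: algebra_simps)
    finally have "x - b * y = (of_int u - of_int w * \<omega>) / D"
      using D0 by (simp add: field_simps)
    then show ?thesis
      using D0 by simp
  qed
  have gpq: "g b p q0 = c b * h / D"
    using lin[of 1 p q0 0] bez unfolding g_def h_def q_def by (simp add: algebra_simps)
  have ch0: "c \<beta> > 0" "h > 0"
    using c less_le_trans[OF _ hge] \<rho> q1 by auto
  have gl: "t \<le> g b p q0"
  proof -
    have "t = (1 - \<kappa>) * c \<beta> * h / hi"
      unfolding hi_def l_def using ch0 \<kappa> t by simp
    also have "\<dots> \<le> c b * h / D"
      using cb D D0 cb0 by (intro frac_le mult_right_mono) (auto simp: h_def)
    finally show ?thesis using gpq by simp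
  qed
  have gr: "g b p q0 \<le> t + \<epsilon>"
  proof -
    have "c b * h / D \<le> (1 + \<kappa>) * c \<beta> * h / lo"
      using cb D D0 cb0 lo0 by (intro frac_le mult_right_mono) (auto simp: h_def)
    also have "\<dots> = t + \<epsilon>"
      unfolding lo_def r_def using ch0 \<kappa> t \<epsilon> by simp
    finally show ?thesis using gpq by simp
  qed
  have main: "t \<le> g b x y" if nz: "(x, y) \<noteq> (0::int, 0::int)" for x y :: int
  proof -
    define u where "u = q' * x - p' * y"
    define w where "w = p * y - q0 * x"
    have xy: "x = p * u + p' * w" "y = q0 * u + q' * w"
      unfolding u_def w_def using bez by algebra+
    have xb: "\<bar>x - b * y\<bar> = \<bar>of_int u - of_int w * \<omega>\<bar> / D"
      by (rule lin[OF u_def w_def])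
    show ?thesis
    proof (cases "w = 0")
      case True
      \<comment> \<open>\<open>(x, y)\<close> is a multiple of \<open>(p, q)\<close>\<close>
      have "u \<noteq> 0" using nz xy True by auto
      then have u: "\<bar>real_of_int u\<bar> \<ge> 1" by linarith
      have "real_of_int x = of_int u * p" "real_of_int y = of_int u * q0"
        using xy True by auto
      moreover have "\<bar>of_int u * p - z * (of_int u * q0)\<bar> = \<bar>of_int u\<bar> * \<bar>p - z * q0\<bar>" for z :: real
        by (simp add: abs_mult[symmetric] algebra_simps)
      ultimately have "g b x y = \<bar>of_int u\<bar> ^ 3 * g b p q0"
        unfolding g_def by (simp add: power3_eq_cube)
      moreover have "1 * g b p q0 \<le> \<bar>of_int u\<bar> ^ 3 * g b p q0"
        using u gl t by (intro mult_right_mono one_le_power) auto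
      ultimately show ?thesis using gl by simp
    next
      case False
      then have w1: "\<bar>real_of_int w\<bar> \<ge> 1" by linarith
      let ?H = "\<bar>x - \<alpha> * y\<bar> * \<bar>x - \<gamma> * y\<bar>"
      show ?thesis
      proof (cases "\<bar>b - \<beta>\<bar> * \<bar>real_of_int y\<bar> \<le> \<kappa> * \<bar>x - \<beta> * y\<bar>")
        case far: True
        have "x - b * y = (x - \<beta> * y) - (b - \<beta>) * y"
          by (simp add: algebra_simps)
        then have "\<bar>x - b * y\<bar> \<ge> \<bar>x - \<beta> * y\<bar> - \<bar>b - \<beta>\<bar> * \<bar>real_of_int y\<bar>"
          unfolding abs_mult[symmetric] by linarith
        then have *: "(1 - \<kappa>) * \<bar>x - \<beta> * y\<bar> \<le> \<bar>x - b * y\<bar>"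
          using far by (simp add: algebra_simps)
        have "t \<le> (1 - \<kappa>)\<^sup>2 * T" using \<kappa>T by simp
        also have "\<dots> \<le> (1 - \<kappa>)\<^sup>2 * g \<beta> x y"
          using T[OF nz] by (intro mult_left_mono) auto
        also have "\<dots> = ((1 - \<kappa>) * c \<beta>) * (?H * ((1 - \<kappa>) * \<bar>x - \<beta> * y\<bar>))"
          unfolding g_def by (simp add: power2_eq_square mult_ac)
        also have "\<dots> \<le> c b * (?H * \<bar>x - b * y\<bar>)"
          using cb(1) * \<kappa> cb0 c by (intro mult_mono mult_nonneg_nonneg) auto
        finally show ?thesis
          by (simp add: g_def mult_ac)
      next
        case near: False
        then have y0: "\<bar>real_of_int y\<bar> > 0" and "\<bar>x - \<beta> * y\<bar> * \<kappa> \<le> \<bar>b - \<beta>\<bar> * \<bar>real_of_int y\<bar>"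
          using \<kappa> by (auto simp: mult_ac)
        then have "\<bar>x - \<beta> * y\<bar> * \<kappa> \<le> 2 / q\<^sup>2 * \<bar>real_of_int y\<bar>"
          using bb mult_right_mono[of "\<bar>b - \<beta>\<bar>" "2 / q\<^sup>2" "\<bar>real_of_int y\<bar>"] by linarith
        then have xb2: "\<bar>x - \<beta> * y\<bar> \<le> (M - 1) / q\<^sup>2 * \<bar>real_of_int y\<bar>"
          using \<kappa> q1 unfolding M_def by (simp add: field_simps)
        \<comment> \<open>the other two factors are large\<close>
        have fac: "\<rho> / 2 * \<bar>real_of_int y\<bar> \<le> \<bar>x - z * y\<bar>" if "\<bar>\<beta> - z\<bar> \<ge> \<rho>" for z :: real
        proof -
          have "(M - 1) / q\<^sup>2 \<le> \<rho> / 2"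
            using Mq q1 by (smt (verit) divide_right_mono zero_le_power2)
          then have "(M - 1) / q\<^sup>2 * \<bar>real_of_int y\<bar> \<le> \<rho> / 2 * \<bar>real_of_int y\<bar>"
            by (rule mult_right_mono) simp
          moreover have "\<rho> * \<bar>real_of_int y\<bar> \<le> \<bar>(\<beta> - z) * y\<bar>"
            unfolding abs_mult using that by (rule mult_right_mono) simp
          moreover have "x - z * y = (x - \<beta> * y) + (\<beta> - z) * y"
            by (simp add: algebra_simps)
          ultimately show ?thesis
            using xb2 by linarith
        qed
        have H: "?H \<ge> (\<rho> / 2 * \<bar>real_of_int y\<bar>) * (\<rho> / 2 * \<bar>real_of_int y\<bar>)"
          using fac \<rho> by (intro mult_mono) auto
        \<comment> \<open>\<open>w\<close> is a nonzero integer, so \<open>x / y\<close> and \<open>p / q\<close> differ by at least \<open>1 / (q * \<bar>y\<bar>)\<close>\<close>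
        have yq: "q \<le> M * \<bar>real_of_int y\<bar>"
        proof -
          have "real_of_int w = (p - q * \<beta>) * y - q * (x - \<beta> * y)"
            unfolding w_def q_def by (simp add: algebra_simps)
          then have "\<bar>real_of_int w\<bar> \<le> \<bar>(p - q * \<beta>) * y\<bar> + \<bar>q * (x - \<beta> * y)\<bar>"
            by (simp only: abs_triangle_ineq4)
          also have "\<dots> = \<bar>p - q * \<beta>\<bar> * \<bar>real_of_int y\<bar> + q * \<bar>x - \<beta> * y\<bar>"
            using q1 by (simp add: abs_mult)
          finally have w2: "\<bar>real_of_int w\<bar> \<le> \<bar>p - q * \<beta>\<bar> * \<bar>real_of_int y\<bar> + q * \<bar>x - \<beta> * y\<bar>" .
          have "p - q * \<beta> = - (q * (\<beta> - p / q))"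
            using q1 by (simp add: field_simps)
          then have "\<bar>p - q * \<beta>\<bar> = q * \<bar>\<beta> - p / q\<bar>"
            using q1 by (simp add: abs_mult)
          also have "\<dots> \<le> q * (1 / q\<^sup>2)"
            using pq q1 by (intro mult_left_mono) auto
          finally have "\<bar>p - q * \<beta>\<bar> * \<bar>real_of_int y\<bar> \<le> q * (1 / q\<^sup>2) * \<bar>real_of_int y\<bar>"
            by (rule mult_right_mono) simp
          moreover have "q * \<bar>x - \<beta> * y\<bar> \<le> q * ((M - 1) / q\<^sup>2 * \<bar>real_of_int y\<bar>)"
            using xb2 q1 by (intro mult_left_mono) auto
          moreover have "q * (1 / q\<^sup>2) * \<bar>real_of_int y\<bar> + q * ((M - 1) / q\<^sup>2 * \<bar>real_of_int y\<bar>) = M * \<bar>real_of_int y\<bar> / q"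
            using q1 by (simp add: field_simps power2_eq_square)
          ultimately have "1 \<le> M * \<bar>real_of_int y\<bar> / q"
            using w1 w2 by linarith
          then show ?thesis
            using q1 by (simp add: field_simps)
        qed
        have low: "t \<le> g b x y" if "t \<le> (1 - \<kappa>) * k * s" "s \<le> \<bar>real_of_int y\<bar>\<^sup>2 * \<bar>x - b * y\<bar>" for s
        proof -
          have "(1 - \<kappa>) * k * s \<le> (1 - \<kappa>) * k * (\<bar>real_of_int y\<bar>\<^sup>2 * \<bar>x - b * y\<bar>)"
            using that(2) \<kappa> k by (intro mult_left_mono) auto
          also have "\<dots> = ((1 - \<kappa>) * c \<beta>) * ((\<rho> / 2 * \<bar>real_of_int y\<bar>) * (\<rho> / 2 * \<bar>real_of_int y\<bar>) * \<bar>x - b * y\<bar>)"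
            unfolding k_def by (simp add: power2_eq_square)
          also have "\<dots> \<le> c b * (?H * \<bar>x - b * y\<bar>)"
            using cb0 \<rho> by (intro mult_mono[OF cb(1)] mult_right_mono[OF H]) auto
          also have "\<dots> = g b x y"
            by (simp add: g_def)
          finally show ?thesis using that(1) by simp
        qed
        show ?thesis
        proof (cases "\<bar>real_of_int y\<bar> \<le> \<bar>of_int w\<bar> * D / 2")
          case True
          have "q * (of_int u - of_int w * \<omega>) = y - of_int w * D"
            unfolding D_def xy(2) q_def by (simp add: algebra_simps)
          then have "q * \<bar>of_int u - of_int w * \<omega>\<bar> = \<bar>y - of_int w * D\<bar>"
            using q1 by (metis abs_mult abs_of_nonneg order_trans zero_le_one)
          moreover have "\<bar>y - of_int w * D\<bar> \<ge> \<bar>of_int w\<bar> * D - \<bar>real_of_int y\<bar>"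
            using D0 abs_triangle_ineq2[of "of_int w * D" "of_int y"] by (simp add: abs_mult abs_minus_commute)
          moreover have "1 * D \<le> \<bar>of_int w\<bar> * D"
            using w1 D0 by (intro mult_right_mono) auto
          ultimately have "D / 2 \<le> q * \<bar>of_int u - of_int w * \<omega>\<bar>"
            using True by linarith
          then have xb3: "1 / (2 * q) \<le> \<bar>x - b * y\<bar>"
            unfolding xb using q1 D0 by (simp add: field_simps)
          have "(q / M)\<^sup>2 \<le> \<bar>real_of_int y\<bar>\<^sup>2"
            using yq q1 M by (intro power_mono) (auto simp: field_simps)
          then have "(q / M)\<^sup>2 * (1 / (2 * q)) \<le> \<bar>real_of_int y\<bar>\<^sup>2 * \<bar>x - b * y\<bar>"
            using xb3 q1 by (intro mult_mono) auto
          moreover have "(q / M)\<^sup>2 * (1 / (2 * q)) = 1 / (2 * M\<^sup>2) * q"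
            using q1 M by (simp add: field_simps power2_eq_square)
          ultimately show ?thesis
            using Qs(5) by (intro low[of "1 / (2 * M\<^sup>2) * q"]) auto
        next
          case False
          have "1 / (4 * \<bar>of_int w\<bar>) \<le> \<bar>of_int u - of_int w * \<omega>\<bar>"
            unfolding \<omega>_def by (rule sqrt2_badly_approximable) fact
          then have "1 / (4 * \<bar>of_int w\<bar>) / D \<le> \<bar>x - b * y\<bar>"
            unfolding xb using D0 by (intro divide_right_mono) auto
          moreover have "1 / (8 * \<bar>real_of_int y\<bar>) \<le> 1 / (4 * (\<bar>of_int w\<bar> * D))"
            using False w1 D0 y0 by (intro divide_left_mono) (auto simp: mult.commute)
          ultimately have "1 / (8 * \<bar>real_of_int y\<bar>) \<le> \<bar>x - b * y\<bar>"
            by (simp add: mult_ac)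
          then have "\<bar>real_of_int y\<bar>\<^sup>2 * (1 / (8 * \<bar>real_of_int y\<bar>)) \<le> \<bar>real_of_int y\<bar>\<^sup>2 * \<bar>x - b * y\<bar>"
            by (rule mult_left_mono) simp
          moreover have "\<bar>real_of_int y\<bar>\<^sup>2 * (1 / (8 * \<bar>real_of_int y\<bar>)) = \<bar>real_of_int y\<bar> / 8"
            using y0 by (simp add: field_simps power2_eq_square)
          moreover have "1 / (8 * M) * q \<le> \<bar>real_of_int y\<bar> / 8"
            using yq M by (simp add: field_simps)
          ultimately show ?thesis
            using Qs(6) by (intro low[of "1 / (8 * M) * q"]) auto
        qed
      qed
    qed
  qed
  have "(p, q0) \<noteq> (0, 0)" using q0 by simp
  moreover have "\<bar>b - \<beta>\<bar> < \<eta>"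
    using b\<eta> \<eta>2 by linarith
  ultimately show ?thesis
    using main gr by blast
qed

section \<open>The spectrum in terms of forms on the integer lattice\<close>

text \<open>The infimum of \<open>\<bar>cubic a b c d\<bar>\<close> over the nonzero integer points.\<close>
definition form_inf :: "real \<Rightarrow> real \<Rightarrow> real \<Rightarrow> real \<Rightarrow> real"
  where "form_inf a b c d =
    (INF (x, y)\<in>UNIV - {(0 :: int, 0 :: int)}. \<bar>cubic a b c d (of_int x) (of_int y)\<bar>)"

lemma form_inf_eqI:
  assumes "integral_ge t a b c d"
    and "\<And>\<epsilon>. \<epsilon> > 0 \<Longrightarrow> \<exists>x y. (x, y) \<noteq> (0, 0) \<and> \<bar>cubic a b c d (of_int x) (of_int y)\<bar> \<le> t + \<epsilon>"
  shows "form_inf a b c d = t"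
  unfolding form_inf_def
proof (rule cInf_eq_non_empty)
  fix z assume *: "\<And>v. v \<in> (\<lambda>(x, y). \<bar>cubic a b c d (of_int x) (of_int y)\<bar>) ` (UNIV - {(0 :: int, 0 :: int)}) \<Longrightarrow> z \<le> v"
  show "z \<le> t"
  proof (rule field_le_epsilon)
    fix \<epsilon> :: real assume "\<epsilon> > 0"
    then obtain x y :: int where "(x, y) \<noteq> (0, 0)" "\<bar>cubic a b c d (of_int x) (of_int y)\<bar> \<le> t + \<epsilon>"
      using assms(2) by blast
    moreover have "z \<le> \<bar>cubic a b c d (of_int x) (of_int y)\<bar>"
      using calculation(1) by (intro *) (auto intro!: image_eqI[of _ _ "(x, y)"])
    ultimately show "z \<le> t + \<epsilon>" by linarith
  qed
next
  have "(1, 0) \<in> UNIV - {(0 :: int, 0 :: int)}" by simp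
  then show "(\<lambda>(x, y). \<bar>cubic a b c d (of_int x) (of_int y)\<bar>) ` (UNIV - {(0 :: int, 0 :: int)}) \<noteq> {}"
    by blast
qed (use assms(1) in \<open>auto simp: integral_ge_def\<close>)

lemma integral_ge_form_inf: "integral_ge (form_inf a b c d) a b c d"
  unfolding integral_ge_def
proof (intro allI impI)
  fix x y :: int assume "(x, y) \<noteq> (0, 0)"
  then show "form_inf a b c d \<le> \<bar>cubic a b c d (of_int x) (of_int y)\<bar>"
    unfolding form_inf_def
    by (intro cInf_lower bdd_belowI[of _ 0]) (auto intro!: image_eqI[of _ _ "(x, y)"])
qed

lemma form_inf_nonneg: "form_inf a b c d \<ge> 0"
  unfolding form_inf_def
proof (rule cInf_greatest)
  have "(1, 0) \<in> UNIV - {(0 :: int, 0 :: int)}" by simp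
  then show "(\<lambda>(x, y). \<bar>cubic a b c d (of_int x) (of_int y)\<bar>) ` (UNIV - {(0 :: int, 0 :: int)}) \<noteq> {}"
    by blast
qed auto

lemma cubic_real_zero:
  fixes a b c d :: real
  obtains x y where "(x, y) \<noteq> (0, 0)" "cubic a b c d x y = 0"
proof -
  define f where "f \<theta> = cubic a b c d (cos \<theta>) (sin \<theta>)" for \<theta>
  have cont: "continuous_on S f" for S
    unfolding f_def cubic_def by (intro continuous_intros)
  have f0: "f pi = - f 0"
    by (simp add: f_def cubic_def)
  have "\<exists>\<theta>. f \<theta> = 0"
  proof (cases "f 0 \<le> 0")
    case True
    then show ?thesis
      using IVT'[of f 0 0 pi] cont f0 by auto
  next
    case False
    then show ?thesis
      using IVT2'[of f pi 0 0] cont f0 by auto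
  qed
  then obtain \<theta> where "f \<theta> = 0" by blast
  then have "cubic a b c d (cos \<theta>) (sin \<theta>) = 0"
    by (simp add: f_def)
  moreover have "(cos \<theta>, sin \<theta>) \<noteq> (0, 0)"
    by (metis Pair_inject add_0 power_zero_numeral sin_cos_squared_add zero_neq_one)
  ultimately show thesis
    using that by blast
qed

text \<open>
  Take a real zero of the form as the first basis vector, complete the square in the remaining
  quadratic factor, and rescale.
\<close>
lemma canonical_form:
  assumes D: "disc a b c d > 0"
  shows "\<exists>r s t u. \<bar>r * u - s * t\<bar> = 1 \<and>
    (\<forall>x y. cubic a b c d (r * x + s * y) (t * x + u * y) =
            cubic 0 (root 4 (disc a b c d / 4)) 0 (- root 4 (disc a b c d / 4)) x y)"
proof -
  let ?D = "disc a b c d"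
  obtain x0 y0 where xy0: "(x0, y0) \<noteq> (0, 0)" "cubic a b c d x0 y0 = 0"
    by (rule cubic_real_zero)
  define n where "n = x0\<^sup>2 + y0\<^sup>2"
  have n: "n > 0"
    using xy0(1) by (auto simp: n_def sum_power2_gt_zero_iff)
  have det1: "x0 * (x0 / n) - (- y0 / n) * y0 = 1"
  proof -
    have "x0 * (x0 / n) - (- y0 / n) * y0 = (x0 * x0 + y0 * y0) / n"
      by (simp add: add_divide_distrib)
    also have "x0 * x0 + y0 * y0 = n"
      by (simp add: n_def power2_eq_square)
    finally show ?thesis using n by simp
  qed
  obtain a1 b1 c1 d1 where 1: 
    "\<And>x y. cubic a1 b1 c1 d1 x y = cubic a b c d (x0 * x + (- y0 / n) * y) (y0 * x + (x0 / n) * y)"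
    "disc a1 b1 c1 d1 = ?D"
    using cubic_subst[of a b c d x0 "- y0 / n" y0 "x0 / n"] unfolding det1 by auto
  have a1: "a1 = 0"
    using 1(1)[of 1 0] xy0(2) by (simp add: cubic_def)
  have D1: "?D = b1\<^sup>2 * (c1\<^sup>2 - 4 * b1 * d1)"
    using 1(2) a1 unfolding disc_def by (simp add: algebra_simps power2_eq_square power3_eq_cube)
  have b1: "b1 \<noteq> 0"
    using D D1 by auto
  define e where "e = (c1\<^sup>2 - 4 * b1 * d1) / (4 * b1)"
  have De: "?D = 4 * b1 ^ 3 * e"
    unfolding D1 e_def using b1 by (simp add: field_simps power2_eq_square power3_eq_cube)
  have be: "b1 * e > 0"
  proof -
    have "?D = (4 * b1\<^sup>2) * (b1 * e)"
      unfolding De by (simp add: power2_eq_square power3_eq_cube)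
    moreover have "4 * b1\<^sup>2 > 0" using b1 by simp
    ultimately show ?thesis
      using D by (metis zero_less_mult_pos)
  qed
  define k where "k = root 4 (?D / 4)"
  have k0: "k > 0" using D by (simp add: k_def)
  have k4: "4 * k ^ 4 = ?D"
    using D by (simp add: k_def)
  define l where "l = k / \<bar>b1\<bar>"
  define \<sigma> where "\<sigma> = sgn b1"
  have l0: "l > 0" using k0 b1 by (simp add: l_def)
  have \<sigma>: "\<sigma> * \<sigma> = 1" "b1 = \<sigma> * \<bar>b1\<bar>" "\<sigma> * b1 = \<bar>b1\<bar>"
    using b1 by (auto simp: \<sigma>_def sgn_if)
  have bl: "\<sigma> * b1 * l = k"
    unfolding \<sigma>(3) l_def using b1 by simp
  have el: "\<sigma> * e = k * l ^ 3"
  proof -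
    have "b1 ^ 3 * e = k ^ 4"
      using k4 De by simp
    then have "(\<sigma> * b1 * l) ^ 3 * (\<sigma> * e) = (\<sigma> * \<sigma>) ^ 2 * k ^ 4 * l ^ 3"
      by algebra
    then have "k ^ 3 * (\<sigma> * e) = k ^ 3 * (k * l ^ 3)"
      unfolding bl \<sigma>(1) by (simp add: eval_nat_numeral)
    then show ?thesis
      using k0 by simp
  qed
  \<comment> \<open>the shear by \<open>g\<close> completes the square; the sign \<open>\<sigma>\<close> makes the leading coefficient positive\<close>
  define g where "g = - c1 / (2 * b1)"
  have sub: "cubic a1 b1 c1 d1 (l * x + g * (\<sigma> / l) * y) (\<sigma> / l * y) = cubic 0 k 0 (- k) x y" for x y
  proof -
    have c1: "c1 = - 2 * b1 * g"
      using b1 by (simp add: g_def)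
    have d1: "d1 = b1 * g\<^sup>2 - e"
      using b1 unfolding e_def g_def by (simp add: field_simps power2_eq_square)
    define Y where "Y = \<sigma> / l * y"
    have Y: "l * Y = \<sigma> * y" using l0 by (simp add: Y_def)
    have "cubic a1 b1 c1 d1 (l * x + g * Y) Y = b1 * (l * x)\<^sup>2 * Y - e * Y ^ 3"
      unfolding cubic_def a1 c1 d1 by algebra
    also have "b1 * (l * x)\<^sup>2 * Y = k * x\<^sup>2 * y"
      using Y bl by algebra
    also have "e * Y ^ 3 = k * y ^ 3"
    proof -
      have "e = \<sigma> * (k * l ^ 3)"
        using el \<sigma>(1) by algebra
      then have "e * Y ^ 3 = \<sigma> * k * (l * Y) ^ 3"
        by algebra
      also have "\<dots> = (\<sigma> * \<sigma>)\<^sup>2 * k * y ^ 3"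
        unfolding Y by algebra
      finally show ?thesis
        using \<sigma>(1) by simp
    qed
    finally show ?thesis
      unfolding Y_def by (simp add: cubic_def mult.assoc)
  qed
  define X where "X = g * (\<sigma> / l)"
  define Z where "Z = \<sigma> / l"
  have XZ: "X = g * Z" by (simp add: X_def Z_def)
  have "cubic a b c d ((x0 * l) * x + (x0 * X + (- y0 / n) * Z) * y) ((y0 * l) * x + (y0 * X + (x0 / n) * Z) * y)
        = cubic 0 k 0 (- k) x y" for x y
  proof -
    have "(x0 * l) * x + (x0 * X + (- y0 / n) * Z) * y = x0 * (l * x + X * y) + (- y0 / n) * (Z * y)"
      "(y0 * l) * x + (y0 * X + (x0 / n) * Z) * y = y0 * (l * x + X * y) + (x0 / n) * (Z * y)"
      by (simp_all add: algebra_simps)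
    then show ?thesis
      using sub[of x y] unfolding 1(1) Z_def[symmetric] XZ[symmetric] by (simp only:)
  qed
  moreover have "(x0 * l) * (y0 * X + (x0 / n) * Z) - (x0 * X + (- y0 / n) * Z) * (y0 * l) = 
      (x0 * (x0 / n) - (- y0 / n) * y0) * (l * Z)"
    by algebra
  then have "\<bar>(x0 * l) * (y0 * X + (x0 / n) * Z) - (x0 * X + (- y0 / n) * Z) * (y0 * l)\<bar> = 1"
    unfolding det1 Z_def \<sigma>_def using l0 b1 by (simp add: abs_sgn_eq)
  ultimately show ?thesis
    unfolding k_def by blast
qed

lemma equivalent_forms:
  assumes D: "disc a b c d > 0" and eq: "disc a' b' c' d' = disc a b c d"
  shows "\<exists>r s t u. \<bar>r * u - s * t\<bar> = 1 \<and>
    (\<forall>x y. cubic a b c d (r * x + s * y) (t * x + u * y) = cubic a' b' c' d' x y)"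
proof -
  define k where "k = root 4 (disc a b c d / 4)"
  obtain r s t u where 1: "\<bar>r * u - s * t\<bar> = 1"
    "\<And>x y. cubic a b c d (r * x + s * y) (t * x + u * y) = cubic 0 k 0 (- k) x y"
    using canonical_form[OF D] unfolding k_def by blast
  obtain r' s' t' u' where 2: "\<bar>r' * u' - s' * t'\<bar> = 1"
    "\<And>x y. cubic a' b' c' d' (r' * x + s' * y) (t' * x + u' * y) = cubic 0 k 0 (- k) x y"
    using canonical_form[of a' b' c' d'] D unfolding k_def eq by auto
  define e where "e = r' * u' - s' * t'"
  have e: "e * e = 1" using 2(1) unfolding e_def[symmetric] by (metis abs_mult_self_eq mult_1)
  \<comment> \<open>multiply by the inverse of the second matrix, whose determinant \<open>e\<close> is its own inverse\<close>
  define R S T U where RSTU: "R = e * (r * u' - s * t')" "S = e * (s * r' - r * s')"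
    "T = e * (t * u' - u * t')" "U = e * (u * r' - t * s')"
  have "cubic a b c d (R * x + S * y) (T * x + U * y) = cubic a' b' c' d' x y" for x y
  proof -
    define X Y where XY: "X = e * (u' * x - s' * y)" "Y = e * (r' * y - t' * x)"
    have "R * x + S * y = r * X + s * Y" "T * x + U * y = t * X + u * Y"
      unfolding RSTU XY by algebra+
    then have "cubic a b c d (R * x + S * y) (T * x + U * y) = cubic a' b' c' d' (r' * X + s' * Y) (t' * X + u' * Y)"
      by (simp only: 1 2)
    also have "r' * X + s' * Y = x"
      using e unfolding XY e_def by algebra
    also have "t' * X + u' * Y = y"
      using e unfolding XY e_def by algebra
    finally show ?thesis .
  qed
  moreover have "R * U - S * T = (e * e) * (r * u - s * t) * e"
    unfolding RSTU e_def by algebra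
  then have "\<bar>R * U - S * T\<bar> = 1"
    using 1(1) 2(1) e by (simp add: abs_mult e_def[symmetric])
  ultimately show ?thesis by blast
qed

text \<open>The matrix with the rows \<open>(r, s)\<close> and \<open>(t, u)\<close>.\<close>
definition mat2 :: "real \<Rightarrow> real \<Rightarrow> real \<Rightarrow> real \<Rightarrow> real ^ 2 ^ 2"
  where "mat2 r s t u = vector [vector [r, s], vector [t, u]]"

lemma mat2_entries [simp]:
  "mat2 r s t u $ 1 $ 1 = r" "mat2 r s t u $ 1 $ 2 = s"
  "mat2 r s t u $ 2 $ 1 = t" "mat2 r s t u $ 2 $ 2 = u"
  by (simp_all only: mat2_def vector_2)

lemma lattice_inf_eq:
  fixes A :: "real ^ 2 ^ 2"
  assumes P: "binary_form 3 P" and L: "lattice_basis L A"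
    and F: "\<And>x y. cubic (bicoeff P 3 0) (bicoeff P 2 1) (bicoeff P 1 2) (bicoeff P 0 3)
       (A $ 1 $ 1 * x + A $ 1 $ 2 * y) (A $ 2 $ 1 * x + A $ 2 $ 2 * y) = cubic a b c d x y"
  shows "(INF v\<in>L - {0}. \<bar>eval_form P v\<bar>) = form_inf a b c d"
proof -
  have ev: "eval_form P v = cubic (bicoeff P 3 0) (bicoeff P 2 1) (bicoeff P 1 2) (bicoeff P 0 3) (v $ 1) (v $ 2)" for v
    unfolding eval_binary_cubic_form[OF P] cubic_def by simp
  have ev2: "eval_form P (A *v z) = cubic a b c d (z $ 1) (z $ 2)" for z
    unfolding ev F[symmetric] by (simp add: matrix_vector_mult_def sum_2)
  have A0: "A *v z = 0 \<longleftrightarrow> z = 0" for z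
  proof
    assume "A *v z = 0"
    moreover obtain B where "B ** A = mat 1"
      using L unfolding lattice_basis_def invertible_def by blast
    ultimately show "z = 0"
      by (metis matrix_vector_mul_assoc matrix_vector_mul_lid matrix_vector_mult_0_right)
  qed simp
  have "L - {0} = (\<lambda>(x :: int, y :: int). A *v vector [of_int x, of_int y]) ` (UNIV - {(0, 0)})"
  proof (intro equalityI subsetI)
    fix v assume v: "v \<in> L - {0}"
    then obtain z where z: "v = A *v z" "\<forall>i. z $ i \<in> \<int>"
      using L unfolding lattice_basis_def by blast
    obtain x y :: int where xy: "z $ 1 = of_int x" "z $ 2 = of_int y"
      using z(2) by (meson Ints_cases)
    have zz: "z = vector [of_int x, of_int y]"
      using xy by (simp add: vec_eq_iff forall_2)
    moreover have "z \<noteq> 0"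
      using v z by auto
    then have "(x, y) \<noteq> (0, 0)"
      using xy by (auto simp: vec_eq_iff forall_2)
    ultimately show "v \<in> (\<lambda>(x :: int, y :: int). A *v vector [of_int x, of_int y]) ` (UNIV - {(0, 0)})"
      using z by (intro image_eqI[of _ _ "(x, y)"]) auto
  next
    fix v assume "v \<in> (\<lambda>(x :: int, y :: int). A *v vector [of_int x, of_int y]) ` (UNIV - {(0, 0)})"
    then obtain x y :: int where xy: "(x, y) \<noteq> (0, 0)" "v = A *v vector [of_int x, of_int y]"
      by auto
    have "v \<in> L"
      using L xy(2) unfolding lattice_basis_def by (force simp: forall_2)
    moreover have "vector [of_int x, of_int y] \<noteq> (0 :: real ^ 2)"
      using xy(1) by (auto simp: vec_eq_iff forall_2)
    then have "v \<noteq> 0"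
      unfolding xy(2) A0 .
    ultimately show "v \<in> L - {0}" by simp
  qed
  then show ?thesis
    unfolding form_inf_def by (simp add: image_image ev2 case_prod_beta')
qed

lemma Spec_eq_form_inf:
  assumes P: "binary_form 3 P" and D: "cubic_disc P > 0"
  shows "Spec P = {form_inf a b c d | a b c d. disc a b c d = cubic_disc P}"
proof -
  define a0 b0 c0 d0 where abcd: "a0 = bicoeff P 3 0" "b0 = bicoeff P 2 1" "c0 = bicoeff P 1 2" "d0 = bicoeff P 0 3"
  have D0: "disc a0 b0 c0 d0 = cubic_disc P"
    by (simp add: disc_def cubic_disc_def abcd Let_def)
  show ?thesis
  proof (intro equalityI subsetI)
    fix m assume "m \<in> Spec P"
    then obtain L where L: "unimodular L" "m = (INF v\<in>L - {0}. \<bar>eval_form P v\<bar>)"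
      unfolding Spec_def by blast
    then obtain A where A: "lattice_basis L A"
      by (auto simp: unimodular_def euclidean_lattice_def)
    have det: "\<bar>A $ 1 $ 1 * A $ 2 $ 2 - A $ 1 $ 2 * A $ 2 $ 1\<bar> = 1"
      using covolume_eq[OF A] L by (simp add: unimodular_def det_2)
    then have det6: "(A $ 1 $ 1 * A $ 2 $ 2 - A $ 1 $ 2 * A $ 2 $ 1) ^ 6 = 1"
      by (metis power_even_abs_numeral even_numeral power_one) 
    obtain a b c d where F: "\<And>x y. cubic a b c d x y =
       cubic a0 b0 c0 d0 (A $ 1 $ 1 * x + A $ 1 $ 2 * y) (A $ 2 $ 1 * x + A $ 2 $ 2 * y)"
      "disc a b c d = disc a0 b0 c0 d0"
      using cubic_subst[of a0 b0 c0 d0 "A $ 1 $ 1" "A $ 1 $ 2" "A $ 2 $ 1" "A $ 2 $ 2"]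
      unfolding det6 by auto
    then have "m = form_inf a b c d"
      unfolding L abcd by (intro lattice_inf_eq[OF P A]) simp
    then show "m \<in> {form_inf a b c d | a b c d. disc a b c d = cubic_disc P}"
      using F(2) D0 by auto
  next
    fix m assume "m \<in> {form_inf a b c d | a b c d. disc a b c d = cubic_disc P}"
    then obtain a b c d where m: "m = form_inf a b c d" "disc a b c d = disc a0 b0 c0 d0"
      using D0 by auto
    obtain r s t u where F: "\<bar>r * u - s * t\<bar> = 1"
      "\<And>x y. cubic a0 b0 c0 d0 (r * x + s * y) (t * x + u * y) = cubic a b c d x y"
      using equivalent_forms[OF _ m(2)] D0 D by auto
    define A where "A = mat2 r s t u"
    define L where "L = {A *v z | z. \<forall>i. z $ i \<in> \<int>}"
    have det: "det A = r * u - s * t"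
      by (simp add: A_def det_2)
    then have A: "lattice_basis L A"
      using F(1) by (auto simp: lattice_basis_def invertible_det_nz L_def)
    have "unimodular L"
      using A covolume_eq[OF A] det F(1) by (auto simp: unimodular_def euclidean_lattice_def)
    moreover have "(INF v\<in>L - {0}. \<bar>eval_form P v\<bar>) = form_inf a b c d"
      using F(2) by (intro lattice_inf_eq[OF P A]) (simp add: A_def abcd)
    ultimately show "m \<in> Spec P"
      unfolding Spec_def m(1) by (auto intro!: exI[of _ L])
  qed
qed

section \<open>Forms with a prescribed infimum\<close>

text \<open>The norm form of the ring \<open>\<int>[2 cos (2 \<pi> / 7)]\<close>, of discriminant \<open>49\<close>.\<close>
definition heptagon :: "int \<Rightarrow> int \<Rightarrow> int"
  where "heptagon x y = x ^ 3 + x\<^sup>2 * y - 2 * x * y\<^sup>2 - y ^ 3"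

text \<open>Infinite descent: the value is odd unless both arguments are even.\<close>
lemma heptagon_nonzero:
  assumes "(x, y) \<noteq> (0, 0)"
  shows "heptagon x y \<noteq> 0"
  using assms
proof (induction "nat (\<bar>x\<bar> + \<bar>y\<bar>)" arbitrary: x y rule: less_induct)
  case less
  show ?case
  proof (cases "even x \<and> even y")
    case True
    then obtain x' y' where xy: "x = 2 * x'" "y = 2 * y'" by (auto elim!: evenE)
    have "heptagon x' y' \<noteq> 0"
      using less.prems xy by (intro less.hyps) auto
    moreover have "heptagon x y = 8 * heptagon x' y'"
      by (simp add: heptagon_def xy power2_eq_square power3_eq_cube algebra_simps)
    ultimately show ?thesis by simp
  next
    case False
    then have "odd (heptagon x y)"
      by (auto simp: heptagon_def)
    then show ?thesis by auto
  qed
qed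

lemma heptagon_roots:
  obtains \<alpha> \<beta> \<gamma> :: real where "\<alpha> < \<beta>" "\<beta> < \<gamma>"
    "\<alpha> + \<beta> + \<gamma> = - 1" "\<alpha> * \<beta> + \<beta> * \<gamma> + \<gamma> * \<alpha> = - 2" "\<alpha> * \<beta> * \<gamma> = 1"
proof -
  define f where "f x = x ^ 3 + x\<^sup>2 - 2 * x - 1" for x :: real
  have cont: "continuous_on S f" for S
    unfolding f_def by (intro continuous_intros)
  obtain \<alpha> where \<alpha>: "-2 \<le> \<alpha>" "\<alpha> \<le> -1" "f \<alpha> = 0"
    using IVT'[of f "-2" 0 "-1"] cont by (auto simp: f_def)
  obtain \<beta> where \<beta>: "-1 \<le> \<beta>" "\<beta> \<le> 0" "f \<beta> = 0"
    using IVT2'[of f 0 0 "-1"] cont by (auto simp: f_def)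
  obtain \<gamma> where \<gamma>: "0 \<le> \<gamma>" "\<gamma> \<le> 2" "f \<gamma> = 0"
    using IVT'[of f 0 0 2] cont by (auto simp: f_def)
  have "f (-1) \<noteq> 0" "f 0 \<noteq> 0" by (auto simp: f_def)
  then have lt: "\<alpha> < \<beta>" "\<beta> < \<gamma>"
    using \<alpha> \<beta> \<gamma> by (metis order_le_less order_less_le_trans)+
  define p where "p = \<alpha> + \<beta> + \<gamma> + 1"
  have dd: "u\<^sup>2 + u * v + v\<^sup>2 + u + v - 2 = 0" if "f u = 0" "f v = 0" "u \<noteq> v" for u v
  proof -
    have "(u - v) * (u\<^sup>2 + u * v + v\<^sup>2 + u + v - 2) = 0"
      using that(1,2) unfolding f_def by algebra
    then show ?thesis using that(3) by simp
  qed
  have 1: "\<alpha>\<^sup>2 + \<alpha> * \<beta> + \<beta>\<^sup>2 + \<alpha> + \<beta> - 2 = 0"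
    using dd[of \<alpha> \<beta>] \<alpha> \<beta> lt by auto
  have 2: "\<beta>\<^sup>2 + \<beta> * \<gamma> + \<gamma>\<^sup>2 + \<beta> + \<gamma> - 2 = 0"
    using dd[of \<beta> \<gamma>] \<beta> \<gamma> lt by auto
  have "(\<gamma> - \<alpha>) * p = 0"
    using 1 2 unfolding p_def by algebra
  then have p: "\<gamma> = - 1 - \<alpha> - \<beta>"
    using lt by (auto simp: p_def)
  have "\<alpha> + \<beta> + \<gamma> = - 1"
    by (simp add: p)
  moreover have "\<alpha> * \<beta> + \<beta> * \<gamma> + \<gamma> * \<alpha> = - 2"
    using 1 unfolding p by algebra
  moreover have "\<alpha> * \<beta> * \<gamma> = 1"
    using 1 \<alpha>(3) unfolding f_def p by algebra
  ultimately show thesis using that lt by blast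
qed

lemma cubic_product:
  "cubic k (- k * (\<alpha> + \<beta> + \<gamma>)) (k * (\<alpha> * \<beta> + \<beta> * \<gamma> + \<gamma> * \<alpha>)) (- k * \<alpha> * \<beta> * \<gamma>) x y
     = k * (x - \<alpha> * y) * (x - \<gamma> * y) * (x - \<beta> * y)"
  unfolding cubic_def by algebra

lemma disc_product:
  "disc k (- k * (\<alpha> + \<beta> + \<gamma>)) (k * (\<alpha> * \<beta> + \<beta> * \<gamma> + \<gamma> * \<alpha>)) (- k * \<alpha> * \<beta> * \<gamma>)
     = k ^ 4 * ((\<alpha> - \<beta>) * (\<beta> - \<gamma>) * (\<gamma> - \<alpha>))\<^sup>2"
  unfolding disc_def by algebra

text \<open>
  Every number \<open>t\<close> below the infimum at \<open>\<beta>\<close> is the infimum at some \<open>b\<close>. By \<open>perturb_root\<close> there are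
  points at which the infimum is slightly above \<open>t\<close>, inside shrinking nested intervals on which some
  value of the form stays below \<open>t + 1 / (n + 1)\<close>. At the limit the infimum is at most \<open>t\<close> by this, and
  at least \<open>t\<close> because each single value of the form is continuous in the root.
\<close>
lemma attained_between:
  fixes \<alpha> \<beta> \<gamma> t T :: real and c :: "real \<Rightarrow> real"
  defines "g \<equiv> (\<lambda>b x y. c b * \<bar>x - \<alpha> * y\<bar> * \<bar>x - \<gamma> * y\<bar> * \<bar>x - b * y\<bar>)"
  assumes t: "0 < t" "t < T" and I: "open I" "\<beta> \<in> I" "\<alpha> \<notin> I" "\<gamma> \<notin> I"
    and c: "continuous_on I c" "\<And>b. b \<in> I \<Longrightarrow> c b > 0"
    and T: "\<And>(x::int) (y::int). (x, y) \<noteq> (0::int, 0::int) \<Longrightarrow> T \<le> g \<beta> x y"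
  shows "\<exists>b\<in>I. (\<forall>(x::int) (y::int). (x, y) \<noteq> (0::int, 0::int) \<longrightarrow> t \<le> g b x y) \<and>
           (\<forall>\<epsilon>>0. \<exists>(x::int) (y::int). (x, y) \<noteq> (0::int, 0::int) \<and> g b x y \<le> t + \<epsilon>)"
proof -
  have isc: "isCont c b" if "b \<in> I" for b
    using c(1) I(1) that by (simp add: continuous_on_eq_continuous_at)
  have gc: "isCont (\<lambda>b. g b x y) b" if "b \<in> I" for b x y
    unfolding g_def using isc[OF that] by (intro continuous_intros)
  define good where "good b \<longleftrightarrow> b \<in> I \<and>
     (\<exists>T>t. \<forall>(x::int) (y::int). (x, y) \<noteq> (0::int, 0::int) \<longrightarrow> T \<le> g b x y)" for b
  obtain r0 where r0: "r0 > 0" "cball \<beta> r0 \<subseteq> I"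
    using I open_contains_cball by blast
  \<comment> \<open>the nested intervals are encoded by their centres and radii\<close>
  define R where "R n s s' \<longleftrightarrow> cball (fst s') (snd s') \<subseteq> cball (fst s) (snd s) \<and>
      snd s' \<le> 1 / real (Suc n) \<and> (\<exists>(x::int) (y::int). (x, y) \<noteq> (0::int, 0::int) \<and>
         (\<forall>b\<in>cball (fst s') (snd s'). g b x y \<le> t + 1 / real (Suc n)))" for n and s s' :: "real \<times> real"
  define S where "S s \<longleftrightarrow> good (fst s) \<and> snd s > 0 \<and> cball (fst s) (snd s) \<subseteq> I" for s
  have step: "\<exists>s'. S s' \<and> R n s s'" if "S s" for n s
  proof -
    obtain b r where s: "s = (b, r)" by fastforce
    have b: "b \<in> I" and r: "r > 0" "cball b r \<subseteq> I"
      using that by (auto simp: S_def good_def s)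
    have "good b" using that by (simp add: S_def s)
    then obtain T' where T': "T' > t" "\<And>(x::int) (y::int). (x, y) \<noteq> (0::int, 0::int) \<Longrightarrow> T' \<le> g b x y"
      unfolding good_def by blast
    \<comment> \<open>aim at \<open>t + e\<close> instead of \<open>t\<close>, so that the new point is good again\<close>
    define v where "v = min (T' - t) (1 / real (Suc n))"
    have v: "v > 0" "v \<le> T' - t" "v \<le> 1 / real (Suc n)"
      using T'(1) by (auto simp: v_def)
    define e where "e = v / 3"
    have e: "e > 0" "e < T' - t" "2 * e < 1 / real (Suc n)"
      using v by (auto simp: e_def)
    have "\<exists>b'. \<bar>b' - b\<bar> < r \<and> (\<forall>(x::int) (y::int). (x, y) \<noteq> (0::int, 0::int) \<longrightarrow> t + e \<le> g b' x y) \<and>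
           (\<exists>(x::int) (y::int). (x, y) \<noteq> (0::int, 0::int) \<and> g b' x y \<le> t + e + e)"
      unfolding g_def
    proof (rule perturb_root)
      show "t + e < T'" using e by linarith
      show "b \<noteq> \<alpha>" "b \<noteq> \<gamma>" using b I by auto
      show "T' \<le> c b * \<bar>x - \<alpha> * y\<bar> * \<bar>x - \<gamma> * y\<bar> * \<bar>x - b * y\<bar>" if "(x, y) \<noteq> (0::int, 0::int)" for x y :: int
        using T'(2)[OF that] by (simp add: g_def)
    qed (use e t b r isc c in auto)
    then obtain b' x y where b': "\<bar>b' - b\<bar> < r" 
      "\<And>(x::int) (y::int). (x, y) \<noteq> (0::int, 0::int) \<Longrightarrow> t + e \<le> g b' x y"
      and xy: "(x, y) \<noteq> (0::int, 0::int)" "g b' x y \<le> t + e + e"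
      by blast
    have b'I: "b' \<in> I"
      using r b'(1) by (auto simp: dist_real_def abs_minus_commute)
    have lt: "g b' x y < t + 1 / real (Suc n)"
      using xy e by linarith
    have "((\<lambda>z. g z x y) \<longlongrightarrow> g b' x y) (nhds b')"
      using gc[OF b'I, of x y] tendsto_at_iff_tendsto_nhds[of "\<lambda>z. g z x y" b']
      by (simp add: isCont_def)
    then have "\<forall>\<^sub>F z in nhds b'. g z x y < t + 1 / real (Suc n)"
      using lt by (rule order_tendstoD(2))
    then obtain d where d: "d > 0" "\<And>z. dist z b' < d \<Longrightarrow> g z x y < t + 1 / real (Suc n)"
      unfolding eventually_nhds_metric by blast
    define r' where "r' = min (d / 2) (min (r - \<bar>b' - b\<bar>) (1 / real (Suc n)))"
    have "r' \<le> d / 2" "r' \<le> r - \<bar>b' - b\<bar>" "r' > 0" and r'n: "r' \<le> 1 / real (Suc n)"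
      unfolding r'_def using d(1) b'(1) by (simp_all only: min.cobounded1 min.coboundedI2 min_less_iff_conj) auto
    then have r': "r' > 0" "r' < d" "\<bar>b' - b\<bar> + r' \<le> r"
      using d by auto
    have sub: "cball b' r' \<subseteq> cball b r"
      using r'(3) by (auto simp: dist_real_def)
    have "\<forall>z\<in>cball b' r'. g z x y \<le> t + 1 / real (Suc n)"
    proof
      fix z assume that: "z \<in> cball b' r'"
      show "g z x y \<le> t + 1 / real (Suc n)"
        using d(2)[of z] that r' by (simp add: dist_commute)
    qed
    then have "R n s (b', r')"
      unfolding R_def s fst_conv snd_conv using sub xy(1) r'n by blast
    moreover have "S (b', r')"
      unfolding S_def good_def using r' sub r b'I b'(2) e(1)
      by (auto intro!: exI[of _ "t + e"])
    ultimately show ?thesis by blast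
  qed
  have "S (\<beta>, r0)"
    using r0 I t T by (auto simp: S_def good_def)
  then obtain s where s: "\<And>n. S (s n)" "\<And>n. R n (s n) (s (Suc n))"
    using dependent_nat_choice[of "\<lambda>n. S" "\<lambda>n. R n"] step by metis
  define B where "B n = cball (fst (s n)) (snd (s n))" for n
  have "B (Suc n) \<subseteq> B n" for n
    using s(2)[of n] by (simp add: R_def B_def)
  then have anti: "B n \<subseteq> B m" if "m \<le> n" for m n
    using that by (rule lift_Suc_antimono_le)
  have "\<Inter> (range B) \<noteq> {}"
  proof (rule compact_nest)
    show "B n \<noteq> {}" for n
      using s(1)[of n] by (auto simp: B_def S_def)
  qed (use anti in \<open>auto simp: B_def\<close>)
  then obtain b where b: "\<And>n. b \<in> B n" by blast
  have bI: "b \<in> I"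
    using b[of 0] s(1)[of 0] by (auto simp: B_def S_def)
  have "(\<lambda>n. fst (s (Suc n))) \<longlonglongrightarrow> b"
  proof (rule metric_LIMSEQ_I)
    fix \<epsilon> :: real assume "\<epsilon> > 0"
    then obtain N where N: "inverse (real (Suc N)) < \<epsilon>"
      using reals_Archimedean by blast
    have "dist (fst (s (Suc n))) b < \<epsilon>" if "n \<ge> N" for n
    proof -
      have "dist (fst (s (Suc n))) b \<le> 1 / real (Suc n)"
        using b[of "Suc n"] s(2)[of n] by (simp add: B_def R_def)
      also have "\<dots> \<le> inverse (real (Suc N))"
        using that by (simp add: divide_inverse)
      finally show ?thesis using N by linarith
    qed
    then show "\<exists>N. \<forall>n\<ge>N. dist (fst (s (Suc n))) b < \<epsilon>" by blast
  qed
  then have lim: "(\<lambda>n. g (fst (s (Suc n))) x y) \<longlonglongrightarrow> g b x y" for x y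
    by (rule isCont_tendsto_compose[OF gc[OF bI]])
  have "t \<le> g b x y" if "(x, y) \<noteq> (0::int, 0::int)" for x y :: int
  proof (rule LIMSEQ_le_const[OF lim])
    have "t \<le> g (fst (s (Suc n))) x y" for n
      using s(1)[of "Suc n"] that unfolding S_def good_def by (meson less_imp_le order_trans)
    then show "\<exists>N. \<forall>n\<ge>N. t \<le> g (fst (s (Suc n))) x y" by blast
  qed
  moreover have "\<exists>(x::int) (y::int). (x, y) \<noteq> (0::int, 0::int) \<and> g b x y \<le> t + \<epsilon>" if \<epsilon>: "\<epsilon> > 0" for \<epsilon>
  proof -
    obtain N where N: "inverse (real (Suc N)) < \<epsilon>"
      using \<epsilon> reals_Archimedean by blast
    obtain x y where xy: "(x, y) \<noteq> (0::int, 0::int)" "\<forall>z\<in>B (Suc N). g z x y \<le> t + 1 / real (Suc N)"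
      using s(2)[of N] unfolding R_def B_def by blast
    then have "g b x y \<le> t + 1 / real (Suc N)"
      using b by blast
    then show ?thesis
      using xy(1) N by (intro exI[of _ x] exI[of _ y]) (auto simp: divide_inverse)
  qed
  ultimately show ?thesis
    using bI by blast
qed

text \<open>
  The extreme value comes from the heptagon form, the value \<open>0\<close> from a form with a rational root, and
  the values in between from \<open>attained_between\<close>.
\<close>
lemma form_inf_attains:
  fixes D t :: real
  assumes D: "D > 0" and t: "0 \<le> t" "t \<le> root 4 (D / 49)"
  shows "\<exists>a b c d. disc a b c d = D \<and> form_inf a b c d = t"
proof -
  define m where "m = root 4 (D / 49)"
  have m: "m > 0" "49 * m ^ 4 = D"
    using D by (simp_all add: m_def)
  obtain \<alpha> \<beta> \<gamma> :: real where lt: "\<alpha> < \<beta>" "\<beta> < \<gamma>" and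
    vieta: "\<alpha> + \<beta> + \<gamma> = - 1" "\<alpha> * \<beta> + \<beta> * \<gamma> + \<gamma> * \<alpha> = - 2" "\<alpha> * \<beta> * \<gamma> = 1"
    by (rule heptagon_roots)
  have D49: "((\<alpha> - \<beta>) * (\<beta> - \<gamma>) * (\<gamma> - \<alpha>))\<^sup>2 = 49"
    using disc_product[of 1 \<alpha> \<beta> \<gamma>] vieta by (simp add: disc_def)
  have kl: "(x - \<alpha> * y) * (x - \<gamma> * y) * (x - \<beta> * y) = of_int (heptagon x y)" for x y :: int
    using cubic_product[of 1 \<alpha> \<beta> \<gamma> x y] vieta by (simp add: cubic_def heptagon_def)
  have kl1: "1 \<le> \<bar>x - \<alpha> * y\<bar> * \<bar>x - \<gamma> * y\<bar> * \<bar>x - \<beta> * y\<bar>" if "(x, y) \<noteq> (0::int, 0::int)" for x y :: int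
  proof -
    have "1 \<le> \<bar>heptagon x y\<bar>"
      using heptagon_nonzero[OF that] by linarith
    then have "1 \<le> \<bar>real_of_int (heptagon x y)\<bar>"
      by linarith
    then show ?thesis
      unfolding kl[symmetric] by (simp add: abs_mult)
  qed
  define c where "c b = root 4 (D / ((\<alpha> - b) * (b - \<gamma>) * (\<gamma> - \<alpha>))\<^sup>2)" for b
  have cb: "c b > 0" "c b ^ 4 * ((\<alpha> - b) * (b - \<gamma>) * (\<gamma> - \<alpha>))\<^sup>2 = D" if "\<alpha> < b" "b < \<gamma>" for b
  proof -
    have nz: "((\<alpha> - b) * (b - \<gamma>) * (\<gamma> - \<alpha>))\<^sup>2 > 0"
      using that by simp
    show "c b > 0"
      using D nz by (simp add: c_def)
    have "c b ^ 4 = D / ((\<alpha> - b) * (b - \<gamma>) * (\<gamma> - \<alpha>))\<^sup>2"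
      unfolding c_def using D nz by (intro real_root_pow_pos2) auto
    then show "c b ^ 4 * ((\<alpha> - b) * (b - \<gamma>) * (\<gamma> - \<alpha>))\<^sup>2 = D"
      using nz by (simp add: field_simps)
  qed
  have c\<beta>: "c \<beta> = m"
    unfolding c_def D49 m_def ..
  \<comment> \<open>it suffices to find the root \<open>b\<close> of a form with roots \<open>\<alpha>\<close>, \<open>b\<close>, \<open>\<gamma>\<close>\<close>
  have form: "\<exists>p q r s. disc p q r s = D \<and> form_inf p q r s = t"
    if b: "\<alpha> < b" "b < \<gamma>" and
      ge: "\<And>(x::int) (y::int). (x, y) \<noteq> (0::int, 0::int) \<Longrightarrow> t \<le> c b * \<bar>x - \<alpha> * y\<bar> * \<bar>x - \<gamma> * y\<bar> * \<bar>x - b * y\<bar>" and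
      le: "\<And>\<epsilon>. \<epsilon> > 0 \<Longrightarrow> \<exists>(x::int) (y::int). (x, y) \<noteq> (0::int, 0::int) \<and>
        c b * \<bar>x - \<alpha> * y\<bar> * \<bar>x - \<gamma> * y\<bar> * \<bar>x - b * y\<bar> \<le> t + \<epsilon>" for b :: real
  proof -
    have "\<bar>cubic (c b) (- c b * (\<alpha> + b + \<gamma>)) (c b * (\<alpha> * b + b * \<gamma> + \<gamma> * \<alpha>)) (- c b * \<alpha> * b * \<gamma>) x y\<bar>
        = c b * \<bar>x - \<alpha> * y\<bar> * \<bar>x - \<gamma> * y\<bar> * \<bar>x - b * y\<bar>" for x y
      unfolding cubic_product using cb(1)[OF b] by (simp add: abs_mult)
    then have "form_inf (c b) (- c b * (\<alpha> + b + \<gamma>)) (c b * (\<alpha> * b + b * \<gamma> + \<gamma> * \<alpha>)) (- c b * \<alpha> * b * \<gamma>) = t"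
      using ge le by (intro form_inf_eqI) (auto simp: integral_ge_def)
    moreover have "disc (c b) (- c b * (\<alpha> + b + \<gamma>)) (c b * (\<alpha> * b + b * \<gamma> + \<gamma> * \<alpha>)) (- c b * \<alpha> * b * \<gamma>) = D"
      unfolding disc_product using cb(2)[OF b] .
    ultimately show ?thesis by blast
  qed
  have m\<beta>: "m \<le> c \<beta> * \<bar>x - \<alpha> * y\<bar> * \<bar>x - \<gamma> * y\<bar> * \<bar>x - \<beta> * y\<bar>" if "(x, y) \<noteq> (0::int, 0::int)" for x y :: int
    using mult_left_mono[OF kl1[OF that], of m] m by (simp add: c\<beta> mult.assoc)
  consider "t = 0" | "t = m" | "0 < t" "t < m"
    using t unfolding m_def by linarith
  then show ?thesis
  proof cases
    case 1
    define k where "k = root 4 (D / 4)"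
    have "4 * k ^ 4 = D"
      using D by (simp add: k_def)
    then have "disc 0 k 0 (- k) = D"
      by (simp add: disc_def power2_eq_square power3_eq_cube power4_eq_xxxx)
    moreover have "form_inf 0 k 0 (- k) = 0"
    proof (rule form_inf_eqI)
      fix \<epsilon> :: real assume "\<epsilon> > 0"
      then show "\<exists>x y. (x, y) \<noteq> (0, 0) \<and> \<bar>cubic 0 k 0 (- k) (of_int x) (of_int y)\<bar> \<le> 0 + \<epsilon>"
        by (intro exI[of _ 1] exI[of _ 0]) (simp add: cubic_def)
    qed (simp add: integral_ge_def)
    ultimately show ?thesis
      using 1 by blast
  next
    case 2
    show ?thesis
    proof (rule form[where b = \<beta>])
      fix \<epsilon> :: real assume "\<epsilon> > 0"
      then show "\<exists>(x::int) (y::int). (x, y) \<noteq> (0::int, 0::int) \<and>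
          c \<beta> * \<bar>x - \<alpha> * y\<bar> * \<bar>x - \<gamma> * y\<bar> * \<bar>x - \<beta> * y\<bar> \<le> t + \<epsilon>"
        using 2 by (intro exI[of _ 1] exI[of _ 0]) (simp add: c\<beta>)
    qed (use lt m\<beta> 2 in auto)
  next
    case 3
    have cont: "continuous_on {\<alpha><..<\<gamma>} c"
      unfolding c_def by (intro continuous_intros) auto
    obtain b :: real where "b \<in> {\<alpha><..<\<gamma>}"
      "\<forall>(x::int) (y::int). (x, y) \<noteq> (0::int, 0::int) \<longrightarrow> t \<le> c b * \<bar>x - \<alpha> * y\<bar> * \<bar>x - \<gamma> * y\<bar> * \<bar>x - b * y\<bar>"
      "\<forall>\<epsilon>>0. \<exists>(x::int) (y::int). (x, y) \<noteq> (0::int, 0::int) \<and>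
        c b * \<bar>x - \<alpha> * y\<bar> * \<bar>x - \<gamma> * y\<bar> * \<bar>x - b * y\<bar> \<le> t + \<epsilon>"
      using attained_between[where t = t and T = m and I = "{\<alpha><..<\<gamma>}" and \<beta> = \<beta> and \<alpha> = \<alpha> and \<gamma> = \<gamma> and c = c] 3 lt cont cb(1) m\<beta> by auto
    then show ?thesis
      by (intro form[where b = b]) auto
  qed
qed

theorem theorem1p5:
  fixes P :: "real poly poly"
  assumes "binary_form 3 P"
    and "cubic_disc P > 0"
  shows "Spec P = {0 .. root 4 (cubic_disc P / 49)}"
proof -
  have "form_inf a b c d \<in> {0..root 4 (cubic_disc P / 49)}" if D: "disc a b c d = cubic_disc P" for a b c d
  proof -
    have "49 * form_inf a b c d ^ 4 \<le> cubic_disc P"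
      using minimum_bound[of a b c d "form_inf a b c d"] D assms(2) integral_ge_form_inf form_inf_nonneg by auto
    then have "root 4 (form_inf a b c d ^ 4) \<le> root 4 (cubic_disc P / 49)"
      by (intro real_root_le_mono) auto
    then show ?thesis
      using form_inf_nonneg[of a b c d] by (simp add: real_root_power_cancel)
  qed
  moreover have "\<exists>a b c d. disc a b c d = cubic_disc P \<and> form_inf a b c d = t"
    if "t \<in> {0..root 4 (cubic_disc P / 49)}" for t
    using form_inf_attains[OF assms(2)] that by auto
  ultimately show ?thesis
    unfolding Spec_eq_form_inf[OF assms] by blast
qed

end
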